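(* Let $X$ be a Banach space, let $\varphi_1,\varphi_2\colon X\to\mathbb{R}_\infty$ be lower semicontinuous, let $\bar x\in\operatorname{dom}\varphi_1\cap\operatorname{dom}\varphi_2$, $\varepsilon>0$ and $\delta>0$. Suppose that $\bar x$ is a quasiuniform $\varepsilon$-minimum of $\varphi_1+\varphi_2$ on $B_\delta(\bar x)$, and that $\varphi_1$ and $\varphi_2$ are bounded from below on $B_\delta(\bar x)$. Then, for any $\eta>0$, there exist points $x_1,x_2\in B_\delta(\bar x)$ such that $$\|x_1-x_2\|<\eta,\qquad \varphi_1(x_1)+\varphi_2(x_2)\le(\varphi_1+\varphi_2)(\bar x),\qquad \operatorname{dist}\bigl(0,\partial^{C}\varphi_1(x_1)+\partial^{C}\varphi_2(x_2)\bigr)<2\varepsilon/\delta.$$ If $X$ is Asplund, then, for any $\eta>0$, there exist points $x_1,x_2\in B_\delta(\bar x)$ such that $$\|x_1-x_2\|<\eta,\qquad \varphi_1(x_1)+\varphi_2(x_2)<(\varphi_1+\varphi_2)(\bar x)+\eta,\qquad \operatorname{dist}\bigl(0,\partial\varphi_1(x_1)+\partial\varphi_2(x_2)\bigr)<2\varepsilon/\delta.$$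
   Context: $\mathbb{R}_\infty:=\mathbb{R}\cup\{+\infty\}$, $\operatorname{dom}\varphi:=\{x\mid\varphi(x)<+\infty\}$, $\operatorname{epi}\varphi:=\{(x,\alpha)\in X\times\mathbb{R}\mid\varphi(x)\le\alpha\}$, $B_\delta(x)$ is the open ball. Conventions: $\inf\emptyset=+\infty$, $\operatorname{dist}(x,\emptyset)=+\infty$; subdifferentials are empty outside the domain. Distances in $X^*$ are with respect to the dual norm. A Banach space is Asplund if every continuous convex function on an open convex set is Fréchet differentiable on a dense subset (equivalently, the dual of each separable subspace is separable). Quasiuniform $\varepsilon$-minimum: a set $V\subset X$ is an essentially interior subset of $U\subset X$ if $\bigcup_{x\in V}B_\rho(x)\subset U$ for some $\rho>0$; $EI(U)$ is the collection of all such $V$ (including $\emptyset$). Put $$\Lambda_U^\circ(\varphi_1,\varphi_2):=\lim_{\eta\downarrow0}\ \inf_{x_1,x_2\in U,\ \|x_1-x_2\|<\eta}(\varphi_1(x_1)+\varphi_2(x_2)),\qquad \Lambda_U^\dagger(\varphi_1,\varphi_2):=\inf_{V\in EI(U)}\Lambda_V^\circ(\varphi_1,\varphi_2).$$ The point $\bar x$ is a quasiuniform $\varepsilon$-minimum of $\varphi_1+\varphi_2$ on $B_\delta(\bar x)$ if $(\varphi_1+\varphi_2)(\bar x)<\Lambda^\dagger_{B_\delta(\bar x)}(\varphi_1,\varphi_2)+\varepsilon$. Fréchet subdifferential of $\varphi$ at $x\in\operatorname{dom}\varphi$: $$\partial\varphi(x):=\Bigl\{x^*\in X^*\Bigm|\liminf_{u\to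 x,\,u\ne x}\frac{\varphi(u)-\varphi(x)-\langle x^*,u-x\rangle}{\|u-x\|}\ge0\Bigr\}.$$ Clarke subdifferential: $\partial^{C}\varphi(x):=\{x^*\in X^*\mid(x^*,-1)\in N^{C}_{\operatorname{epi}\varphi}(x,\varphi(x))\}$, where for a subset $\Omega$ of a normed space $Z$ and $z\in\Omega$, $N^{C}_\Omega(z):=\{z^*\in Z^*\mid\langle z^*,d\rangle\le0\ \forall d\in T^{C}_\Omega(z)\}$ and $T^{C}_\Omega(z)$ is the set of all $d\in Z$ such that for all sequences $z_k\to z$ in $\Omega$ and $t_k\downarrow0$ there is a sequence $d_k\to d$ with $z_k+t_kd_k\in\Omega$ for all $k\in\mathbb{N}$. *)

theory Defs
  imports "HOL-Analysis.Analysis" "HOL-Library.Set_Algebras"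
begin

text \<open>
  Functions into \<open>\<real> \<union> {+\<infinity>}\<close> are functions into \<^typ>\<open>ereal\<close> that avoid \<open>-\<infinity>\<close>. The dual of \<open>'a\<close>
  is \<open>'a \<Rightarrow>\<^sub>L real\<close>, whose norm is the operator norm, that is, the dual norm.
\<close>

definition avoids_minus_infinity :: "('a \<Rightarrow> ereal) \<Rightarrow> bool" where
  "avoids_minus_infinity \<phi> \<longleftrightarrow> (\<forall>x. \<phi> x \<noteq> -\<infinity>)"

definition edom :: "('a \<Rightarrow> ereal) \<Rightarrow> 'a set" where
  "edom \<phi> = {x. \<phi> x < \<infinity>}"

definition eepi :: "('a \<Rightarrow> ereal) \<Rightarrow> ('a \<times> real) set" where
  "eepi \<phi> = {(x, \<alpha>). \<phi> x \<le> ereal \<alpha>}"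

definition lsc :: "('a::topological_space \<Rightarrow> ereal) \<Rightarrow> bool" where
  "lsc \<phi> \<longleftrightarrow> (\<forall>x. \<phi> x \<le> Liminf (at x) \<phi>)"

definition bounded_below_on :: "'a set \<Rightarrow> ('a \<Rightarrow> ereal) \<Rightarrow> bool" where
  "bounded_below_on U \<phi> \<longleftrightarrow> (\<exists>c::real. \<forall>x\<in>U. ereal c \<le> \<phi> x)"

text \<open>
  The library's \<^const>\<open>infdist\<close> is \<open>0\<close> for the empty set; here the distance to the empty set
  has to be \<open>+\<infinity>\<close>.
\<close>

definition edistance :: "'a::metric_space \<Rightarrow> 'a set \<Rightarrow> ereal" where
  "edistance x A = (INF a\<in>A. ereal (dist x a))"

lemma edistance_empty: "edistance x {} = \<infinity>"
  by (simp add: edistance_def top_ereal_def)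

text \<open>Frechet differentiability at a point is the library's \<^const>\<open>differentiable\<close>.\<close>

definition asplund :: "'a::banach itself \<Rightarrow> bool" where
  "asplund (T :: 'a itself) \<longleftrightarrow>
     (\<forall>(U :: 'a set) (f :: 'a \<Rightarrow> real).
        open U \<and> convex U \<and> continuous_on U f \<and> convex_on U f \<longrightarrow>
        U \<subseteq> closure {x \<in> U. f differentiable (at x)})"

definition EI :: "'a::metric_space set \<Rightarrow> 'a set set" where
  "EI U = {V. \<exists>\<rho>>0. (\<Union>x\<in>V. ball x \<rho>) \<subseteq> U}"

definition Lambda_circ ::
  "'a::real_normed_vector set \<Rightarrow> ('a \<Rightarrow> ereal) \<Rightarrow> ('a \<Rightarrow> ereal) \<Rightarrow> ereal" where
  "Lambda_circ U \<phi>1 \<phi>2 =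
     Lim (at_right (0::real))
       (\<lambda>\<eta>. INF (x1, x2) \<in> {(x1, x2). x1 \<in> U \<and> x2 \<in> U \<and> norm (x1 - x2) < \<eta>}. \<phi>1 x1 + \<phi>2 x2)"

text \<open>The limit exists, by monotonicity, so \<^const>\<open>Lim\<close> is meaningful.\<close>

lemma Lambda_circ_tendsto:
  fixes \<phi>1 \<phi>2 :: "'a::real_normed_vector \<Rightarrow> ereal"
  shows "((\<lambda>\<eta>. INF (x1, x2) \<in> {(x1, x2). x1 \<in> U \<and> x2 \<in> U \<and> norm (x1 - x2) < \<eta>}. \<phi>1 x1 + \<phi>2 x2)
          \<longlongrightarrow> Lambda_circ U \<phi>1 \<phi>2) (at_right (0::real))"
proof -
  define g :: "real \<Rightarrow> ereal" where "g = (\<lambda>\<eta>. INF (x1, x2) \<in>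
    {(x1, x2). x1 \<in> U \<and> x2 \<in> U \<and> norm (x1 - x2) < \<eta>}. \<phi>1 x1 + \<phi>2 x2)"
  have anti: "g b \<le> g a" if "a \<le> b" for a b
    unfolding g_def using that by (intro INF_superset_mono) auto
  have lim: "(g \<longlongrightarrow> (SUP \<eta>\<in>{0<..}. g \<eta>)) (at_right 0)"
  proof (rule order_tendstoI)
    fix a assume "a < (SUP \<eta>\<in>{0<..}. g \<eta>)"
    then obtain b where b: "0 < b" "a < g b"
      by (auto simp: less_SUP_iff)
    have "a < g \<eta>" if "0 < \<eta>" "\<eta> < b" for \<eta>
      using b anti[of \<eta> b] that by (auto intro: less_le_trans)
    then show "eventually (\<lambda>\<eta>. a < g \<eta>) (at_right 0)"
      using b by (auto simp: eventually_at_right_field)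
  next
    fix a assume a: "(SUP \<eta>\<in>{0<..}. g \<eta>) < a"
    have "g \<eta> < a" if "0 < \<eta>" for \<eta>
      by (rule le_less_trans[OF SUP_upper a]) (use that in auto)
    then show "eventually (\<lambda>\<eta>. g \<eta> < a) (at_right 0)"
      by (auto simp: eventually_at_right_field intro: exI[of _ 1])
  qed
  then have "Lim (at_right 0) g = (SUP \<eta>\<in>{0<..}. g \<eta>)"
    by (intro tendsto_Lim) auto
  with lim show ?thesis
    unfolding Lambda_circ_def g_def by simp
qed

definition Lambda_dagger ::
  "'a::real_normed_vector set \<Rightarrow> ('a \<Rightarrow> ereal) \<Rightarrow> ('a \<Rightarrow> ereal) \<Rightarrow> ereal" where
  "Lambda_dagger U \<phi>1 \<phi>2 = (INF V\<in>EI U. Lambda_circ V \<phi>1 \<phi>2)"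

definition quasiuniform_min ::
  "real \<Rightarrow> real \<Rightarrow> ('a::real_normed_vector \<Rightarrow> ereal) \<Rightarrow> ('a \<Rightarrow> ereal) \<Rightarrow> 'a \<Rightarrow> bool" where
  "quasiuniform_min \<epsilon> \<delta> \<phi>1 \<phi>2 xb \<longleftrightarrow>
     \<phi>1 xb + \<phi>2 xb < Lambda_dagger (ball xb \<delta>) \<phi>1 \<phi>2 + ereal \<epsilon>"

definition frechet_subdiff ::
  "('a::real_normed_vector \<Rightarrow> ereal) \<Rightarrow> 'a \<Rightarrow> ('a \<Rightarrow>\<^sub>L real) set" where
  "frechet_subdiff \<phi> x =
     {x'. x \<in> edom \<phi> \<and>
          Liminf (at x) (\<lambda>u. (\<phi> u - \<phi> x - ereal (blinfun_apply x' (u - x))) / ereal (norm (u - x))) \<ge> 0}"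

text \<open>
  In the Clarke cones, \<open>t\<^sub>k \<down> 0\<close> means \<open>t\<^sub>k > 0\<close> and \<open>t\<^sub>k \<longlonglongrightarrow> 0\<close>. Both cones are only used at points
  of \<open>\<Omega>\<close>.
\<close>

definition clarke_tangent :: "'z::real_normed_vector set \<Rightarrow> 'z \<Rightarrow> 'z set" where
  "clarke_tangent \<Omega> z =
     {d. \<forall>(zs :: nat \<Rightarrow> 'z) (t :: nat \<Rightarrow> real).
           (\<forall>k. zs k \<in> \<Omega>) \<and> zs \<longlonglongrightarrow> z \<and> (\<forall>k. t k > 0) \<and> t \<longlonglongrightarrow> 0 \<longrightarrow>
           (\<exists>ds :: nat \<Rightarrow> 'z. ds \<longlonglongrightarrow> d \<and> (\<forall>k. zs k + t k *\<^sub>R ds k \<in> \<Omega>))}"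

definition clarke_normal :: "'z::real_normed_vector set \<Rightarrow> 'z \<Rightarrow> ('z \<Rightarrow>\<^sub>L real) set" where
  "clarke_normal \<Omega> z = {z'. \<forall>d\<in>clarke_tangent \<Omega> z. blinfun_apply z' d \<le> 0}"

text \<open>
  The functional \<open>(x\<^sup>*, -1)\<close> on \<open>X \<times> \<real>\<close> is \<open>(u, r) \<mapsto> \<langle>x\<^sup>*, u\<rangle> - r\<close>. The library's norm on
  \<open>X \<times> \<real>\<close> is the Euclidean combination of the two norms; the Clarke cones depend only on the
  topology, hence not on the choice of an equivalent product norm.
\<close>

definition clarke_subdiff ::
  "('a::real_normed_vector \<Rightarrow> ereal) \<Rightarrow> 'a \<Rightarrow> ('a \<Rightarrow>\<^sub>L real) set" where
  "clarke_subdiff \<phi> x =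
     {x'. x \<in> edom \<phi> \<and>
          (x' o\<^sub>L fst_blinfun) - snd_blinfun \<in> clarke_normal (eepi \<phi>) (x, real_of_ereal (\<phi> x))}"

end

theory Submission
  imports Defs
begin

text \<open>
  Fix a ball slightly smaller than the given one. A quasiuniform \<open>\<epsilon>\<close>-minimum has a gap that is
  uniform for pairs of nearby points, so the decoupled sum with the penalty
  \<open>\<gamma> * norm (u1 - u2)\<close> and a large \<open>\<gamma>\<close> has an \<open>\<epsilon>'\<close>-minimum, \<open>\<epsilon>' < \<epsilon>\<close>, at the diagonal point
  over the square of that ball. Ekeland's variational principle replaces it by an exact minimum at
  a pair \<open>(z1, z2)\<close> of interior points, after adding the terms \<open>c * norm (u1 - z1)\<close> and
  \<open>c * norm (u2 - z2)\<close> with \<open>c < \<epsilon> / \<delta>\<close> (\<open>penalized_ekeland_pair\<close>). What remains are two fuzzy sum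
  rules at this pair, in which the coupling term contributes a functional and its
  negative, and only the slope \<open>2 * c\<close> survives in the sum.

  Clarke subdifferentials: the Clarke tangent cones of the epigraphs are convex, minimality says
  that a sublinear function is nonnegative on their product in the appropriate sense, and the
  Hahn-Banach theorem separates (\<open>clarke_fuzzy_sum\<close>).

  Frechet subdifferentials in Asplund spaces: the proof works directly with the differentiability
  of convex functions, without separable reduction or smooth renormings. For a Lipschitz function \<open>V\<close>, the supremum of
  its difference quotients over a small ball is a continuous sublinear function of the direction.
  A point where that function is Frechet differentiable, combined with an almost steepest segment, gives a point
  where \<open>V\<close> has an affine lower estimate with an arbitrarily small relative error
  (\<open>asplund_lipschitz_almost_support\<close>). Applied to the infimal convolution of the decoupled sum with
  its penalty, this yields approximate Frechet subgradients \<open>a\<close> and \<open>- a\<close> of the two functions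
  (\<open>decoupled_supports\<close>). Applied to the infimal convolution of one function with a cone, it improves a
  local support of slope \<open>r\<close> to one of slope \<open>\<epsilon>\<close> nearby, with a functional about \<open>r\<close>
  away (\<open>refine_support\<close>). Iterating the improvement leads in the limit
  to an exact Frechet subgradient (\<open>exact_support\<close>), because each step preserves a weakened
  form of the estimate of the step before on the whole ball of that step.
\<close>

section \<open>Lower semicontinuity and Ekeland's variational principle\<close>

text \<open>
  The finite part of an extended-real-valued function is handled as a real function \<open>F\<close> on its
  domain \<open>D\<close>; this is what lower semicontinuity of the extended function says about sequences with
  convergent values. Such sequences are all that Ekeland's argument produces, since there the values
  decrease and are bounded below, and the restriction makes it evident that adding a continuous
  function preserves the property.
\<close>

definition seq_lsc_on :: "'a::topological_space set \<Rightarrow> ('a \<Rightarrow> real) \<Rightarrow> bool" where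
  "seq_lsc_on D F \<longleftrightarrow>
     (\<forall>v x c. (\<forall>n. v n \<in> D) \<and> v \<longlonglongrightarrow> x \<and> (\<lambda>n. F (v n)) \<longlonglongrightarrow> c \<longrightarrow> x \<in> D \<and> F x \<le> c)"

lemma seq_lsc_onI:
  assumes "\<And>v x c. \<lbrakk>\<And>n. v n \<in> D; v \<longlonglongrightarrow> x; (\<lambda>n. F (v n)) \<longlonglongrightarrow> c\<rbrakk> \<Longrightarrow> x \<in> D \<and> F x \<le> c"
  shows "seq_lsc_on D F"
  unfolding seq_lsc_on_def using assms by blast

lemma seq_lsc_onD:
  assumes "seq_lsc_on D F" "\<And>n. v n \<in> D" "v \<longlonglongrightarrow> x" "(\<lambda>n. F (v n)) \<longlonglongrightarrow> c"
  shows "x \<in> D" "F x \<le> c"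
  using assms unfolding seq_lsc_on_def by blast+

lemma seq_lsc_on_add_continuous:
  assumes F: "seq_lsc_on D F" and G: "continuous_on UNIV G"
  shows "seq_lsc_on D (\<lambda>x. F x + G x)"
proof (rule seq_lsc_onI)
  fix v x c
  assume v: "\<And>n. v n \<in> D" "v \<longlonglongrightarrow> x" and c: "(\<lambda>n. F (v n) + G (v n)) \<longlonglongrightarrow> c"
  have "(\<lambda>n. G (v n)) \<longlonglongrightarrow> G x"
    using continuous_on_tendsto_compose[OF G v(2)] by simp
  from tendsto_diff[OF c this] have "(\<lambda>n. F (v n)) \<longlonglongrightarrow> c - G x" by simp
  from seq_lsc_onD[OF F v this] show "x \<in> D \<and> F x + G x \<le> c" by simp
qed

lemma seq_lsc_on_Int_closed:
  assumes F: "seq_lsc_on D F" and S: "closed S"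
  shows "seq_lsc_on (D \<inter> S) F"
proof (rule seq_lsc_onI)
  fix v x c
  assume v: "\<And>n. v n \<in> D \<inter> S" "v \<longlonglongrightarrow> x" and c: "(\<lambda>n. F (v n)) \<longlonglongrightarrow> c"
  have "x \<in> S" using closed_sequentially[OF S _ v(2)] v(1) by blast
  with seq_lsc_onD[OF F _ v(2) c] v(1) show "x \<in> D \<inter> S \<and> F x \<le> c" by blast
qed

text \<open>
  Convergence of the sums does not give convergence of the summands, but the lower bounds confine
  the values of \<open>F1\<close> to a bounded interval, and a subsequence on which they converge suffices.
\<close>

lemma seq_lsc_on_sum:
  assumes lsc1: "seq_lsc_on D1 F1" and lsc2: "seq_lsc_on D2 F2"
    and bdd: "\<And>x. x \<in> D1 \<Longrightarrow> b1 \<le> F1 x" "\<And>x. x \<in> D2 \<Longrightarrow> b2 \<le> F2 x"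
  shows "seq_lsc_on (D1 \<times> D2) (\<lambda>w. F1 (fst w) + F2 (snd w))"
proof (rule seq_lsc_onI)
  fix v x c
  assume v: "\<And>n. v n \<in> D1 \<times> D2" "v \<longlonglongrightarrow> x"
    and c: "(\<lambda>n. F1 (fst (v n)) + F2 (snd (v n))) \<longlonglongrightarrow> c"
  have vD: "fst (v n) \<in> D1" "snd (v n) \<in> D2" for n using v(1)[of n] by (auto simp: mem_Times_iff)
  obtain B where B: "\<And>n. norm (F1 (fst (v n)) + F2 (snd (v n))) \<le> B"
    using convergent_imp_Bseq[OF convergentI[OF c]] by (auto simp: Bseq_def)
  have "norm (F1 (fst (v n))) \<le> \<bar>b1\<bar> + \<bar>B\<bar> + \<bar>b2\<bar>" for n
    using B[of n] bdd(1)[OF vD(1)[of n]] bdd(2)[OF vD(2)[of n]] unfolding real_norm_def by linarith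
  then have "bounded (range (\<lambda>n. F1 (fst (v n))))" by (auto simp: bounded_iff)
  then obtain l r where r: "strict_mono r" and l: "((\<lambda>n. F1 (fst (v n))) \<circ> r) \<longlonglongrightarrow> l"
    using bounded_imp_convergent_subsequence by blast
  have vr: "(\<lambda>n. v (r n)) \<longlonglongrightarrow> x" using LIMSEQ_subseq_LIMSEQ[OF v(2) r] by (simp add: o_def)
  have l1: "(\<lambda>n. F1 (fst (v (r n)))) \<longlonglongrightarrow> l" using l by (simp add: o_def)
  have "(\<lambda>n. F1 (fst (v (r n))) + F2 (snd (v (r n)))) \<longlonglongrightarrow> c"
    using LIMSEQ_subseq_LIMSEQ[OF c r] by (simp add: o_def)
  from tendsto_diff[OF this l1] have l2: "(\<lambda>n. F2 (snd (v (r n)))) \<longlonglongrightarrow> c - l" by simp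
  from seq_lsc_onD[OF lsc1 vD(1) tendsto_fst[OF vr] l1] seq_lsc_onD[OF lsc2 vD(2) tendsto_snd[OF vr] l2]
  show "x \<in> D1 \<times> D2 \<and> F1 (fst x) + F2 (snd x) \<le> c" by (auto simp: mem_Times_iff)
qed

lemma seq_lsc_on_lsc:
  fixes \<phi> :: "'a::metric_space \<Rightarrow> ereal"
  assumes lsc: "lsc \<phi>" and ninf: "avoids_minus_infinity \<phi>"
  shows "seq_lsc_on (edom \<phi>) (\<lambda>x. real_of_ereal (\<phi> x))"
proof (rule seq_lsc_onI)
  fix v x c
  assume v: "\<And>n. v n \<in> edom \<phi>" "v \<longlonglongrightarrow> x" and c: "(\<lambda>n. real_of_ereal (\<phi> (v n))) \<longlonglongrightarrow> c"
  have fin: "\<bar>\<phi> u\<bar> \<noteq> \<infinity>" if "u \<in> edom \<phi>" for u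
    using that ninf by (auto simp: edom_def avoids_minus_infinity_def)
  have "\<phi> x \<le> ereal c"
  proof (rule ccontr)
    assume "\<not> \<phi> x \<le> ereal c"
    then obtain y where y: "ereal c < y" "y < \<phi> x" using dense[of "ereal c" "\<phi> x"] by (auto simp: not_le)
    have "\<forall>\<^sub>F u in at x. y < \<phi> u"
      using lsc y(2) unfolding lsc_def le_Liminf_iff by blast
    with y(2) have "\<forall>\<^sub>F u in nhds x. y < \<phi> u"
      by (simp add: eventually_nhds_conv_at)
    then have "\<forall>\<^sub>F n in sequentially. y < \<phi> (v n)"
      using v(2) by (rule eventually_compose_filterlim)
    then have "\<forall>\<^sub>F n in sequentially. y \<le> ereal (real_of_ereal (\<phi> (v n)))"
      by eventually_elim (use fin v(1) in \<open>simp add: ereal_real'\<close>)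
    moreover have "(\<lambda>n. ereal (real_of_ereal (\<phi> (v n)))) \<longlonglongrightarrow> ereal c" using c by simp
    ultimately have "y \<le> ereal c" by (intro tendsto_lowerbound) auto
    with y(1) show False by simp
  qed
  moreover from this have "x \<in> edom \<phi>" by (auto simp: edom_def le_less_trans)
  ultimately show "x \<in> edom \<phi> \<and> real_of_ereal (\<phi> x) \<le> c"
    using fin[of x] by (cases "\<phi> x") auto
qed

lemma telescoping_limit:
  fixes z :: "nat \<Rightarrow> 'b::complete_space" and e :: "nat \<Rightarrow> real"
  assumes step: "\<And>n. dist (z (Suc n)) (z n) \<le> e n - e (Suc n)" and e: "e \<longlonglongrightarrow> l"
  obtains x where "z \<longlonglongrightarrow> x" "\<And>n. dist x (z n) \<le> e n - l"
proof -
  have D: "dist (z m) (z n) \<le> e n - e m" if "n \<le> m" for n m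
    using that
  proof (induction m rule: dec_induct)
    case (step m)
    have "dist (z (Suc m)) (z n) \<le> dist (z (Suc m)) (z m) + dist (z m) (z n)"
      by (rule dist_triangle)
    with assms(1)[of m] step.IH show ?case by linarith
  qed simp
  have l: "l \<le> e n" for n
  proof (rule LIMSEQ_le_const2[OF e])
    show "\<exists>N. \<forall>m\<ge>N. e m \<le> e n"
      using D zero_le_dist by (metis diff_ge_0_iff_ge order_trans)
  qed
  have "Cauchy z"
  proof (rule metric_CauchyI)
    fix r :: real assume "r > 0"
    then obtain N where N: "\<And>n. n \<ge> N \<Longrightarrow> \<bar>e n - l\<bar> < r"
      using e unfolding LIMSEQ_iff by fastforce
    have *: "dist (z m) (z n) < r" if "N \<le> n" "n \<le> m" for m n
      using D[OF that(2)] l[of m] N[OF that(1)] by linarith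
    show "\<exists>M. \<forall>m\<ge>M. \<forall>n\<ge>M. dist (z m) (z n) < r"
      using * by (metis dist_commute nat_le_linear)
  qed
  then obtain x where x: "z \<longlonglongrightarrow> x" by (metis Cauchy_convergent_iff convergent_def)
  have "dist x (z n) \<le> e n - l" for n
  proof (rule LIMSEQ_le[OF tendsto_dist[OF x tendsto_const] tendsto_diff[OF tendsto_const e]])
    show "\<exists>N. \<forall>m\<ge>N. dist (z m) (z n) \<le> e n - e m" using D by blast
  qed
  with x show thesis by (rule that)
qed

text \<open>
  Ekeland's variational principle: the sets \<open>S (x n)\<close> of points that are better than \<open>x n\<close> by the
  slope \<open>c\<close> decrease along a sequence of near-minimizers over them, so that no point can improve
  on the limit.
\<close>

lemma ekeland:
  fixes F :: "'b::complete_space \<Rightarrow> real"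
  assumes lsc: "seq_lsc_on D F" and x0: "x0 \<in> D" and bdd: "\<And>x. x \<in> D \<Longrightarrow> b \<le> F x" and c: "c > 0"
  obtains x where "x \<in> D" "F x + c * dist x x0 \<le> F x0"
    "\<And>u. u \<in> D \<Longrightarrow> F x \<le> F u + c * dist u x"
proof -
  define S where "S x = {u \<in> D. F u + c * dist u x \<le> F x}" for x
  have "\<exists>y. y \<in> S x \<and> (\<forall>u\<in>S x. F y \<le> F u + (1/2) ^ n)" if "x \<in> D" for x n
  proof -
    have ne: "S x \<noteq> {}" using that by (auto simp: S_def)
    have bb: "bdd_below (F ` S x)" using bdd by (intro bdd_belowI2[of _ b]) (auto simp: S_def)
    have "\<exists>v\<in>F ` S x. v < Inf (F ` S x) + (1/2) ^ n"
      using ne by (intro cInf_lessD) auto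
    then obtain y where y: "y \<in> S x" "F y < Inf (F ` S x) + (1/2) ^ n" by blast
    have "F y \<le> F u + (1/2) ^ n" if "u \<in> S x" for u
      using cInf_lower[OF imageI[OF that] bb] y(2) by linarith
    with y show ?thesis by blast
  qed
  then have ex: "\<exists>y. y \<in> D \<and> (y \<in> S x \<and> (\<forall>u\<in>S x. F y \<le> F u + (1/2) ^ n))" if "x \<in> D" for x n
    using that by (fastforce simp: S_def)
  obtain x where x0': "x 0 = x0" and xD: "\<And>n. x n \<in> D" and xS: "\<And>n. x (Suc n) \<in> S (x n)"
    and xm: "\<And>n u. u \<in> S (x n) \<Longrightarrow> F (x (Suc n)) \<le> F u + (1/2) ^ n"
  proof -
    have "\<exists>x. \<forall>n. (x n \<in> D \<and> (n = 0 \<longrightarrow> x n = x0)) \<and>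
        (x (Suc n) \<in> S (x n) \<and> (\<forall>u\<in>S (x n). F (x (Suc n)) \<le> F u + (1/2) ^ n))"
      using ex x0 by (intro dependent_nat_choice) auto
    then show thesis using that by blast
  qed
  have dec: "F (x (Suc n)) + c * dist (x (Suc n)) (x n) \<le> F (x n)" for n
    using xS[of n] by (simp add: S_def)
  have "decseq (\<lambda>n. F (x n))"
  proof (rule decseq_SucI)
    fix n show "F (x (Suc n)) \<le> F (x n)"
      using dec[of n] mult_nonneg_nonneg[of c "dist (x (Suc n)) (x n)"] c by (smt (verit) zero_le_dist)
  qed
  then obtain l where l: "(\<lambda>n. F (x n)) \<longlonglongrightarrow> l"
    using decseq_convergent[of "\<lambda>n. F (x n)" b] bdd xD by blast
  have "dist (x (Suc n)) (x n) \<le> F (x n) / c - F (x (Suc n)) / c" for n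
    using dec[of n] c by (simp add: field_simps)
  moreover have "(\<lambda>n. F (x n) / c) \<longlonglongrightarrow> l / c" using l c by (intro tendsto_intros) auto
  ultimately obtain y where y: "x \<longlonglongrightarrow> y" and yd: "\<And>n. dist y (x n) \<le> F (x n) / c - l / c"
    using telescoping_limit[where e = "\<lambda>n. F (x n) / c" and z = x] by blast
  have yD: "y \<in> D" and Fy: "F y \<le> l" using seq_lsc_onD[OF lsc xD y l] by auto
  have yS: "F y + c * dist y (x n) \<le> F (x n)" for n
    using yd[of n] Fy c by (simp add: field_simps)
  show thesis
  proof
    show "y \<in> D" by fact
    show "F y + c * dist y x0 \<le> F x0" using yS[of 0] x0' by simp
    fix u assume u: "u \<in> D"
    show "F y \<le> F u + c * dist u y"
    proof (rule ccontr)
      assume "\<not> F y \<le> F u + c * dist u y"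
      then have less: "F u + c * dist u y < F y" by simp
      have "u \<in> S (x n)" for n
      proof -
        have "c * dist u (x n) \<le> c * dist u y + c * dist y (x n)"
          using dist_triangle[of u "x n" y] c
          by (metis distrib_left less_imp_le mult_left_mono)
        then show ?thesis using less yS[of n] u by (simp add: S_def)
      qed
      then have le: "F (x (Suc n)) \<le> F u + (1/2) ^ n" for n by (rule xm)
      have "(\<lambda>n. F (x (Suc n))) \<longlonglongrightarrow> l" using l by (rule LIMSEQ_Suc)
      moreover have "(\<lambda>n. F u + (1/2) ^ n) \<longlonglongrightarrow> F u + 0"
        by (intro tendsto_intros LIMSEQ_power_zero) auto
      ultimately have "l \<le> F u + 0" by (rule LIMSEQ_le) (use le in blast)
      moreover have "0 \<le> c * dist u y" using c by simp
      ultimately show False using less Fy by linarith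
    qed
  qed
qed


section \<open>The Hahn-Banach theorem\<close>

definition sublinear :: "('a::real_vector \<Rightarrow> real) \<Rightarrow> bool" where
  "sublinear q \<longleftrightarrow> (\<forall>x y. q (x + y) \<le> q x + q y) \<and> (\<forall>t x. 0 < t \<longrightarrow> q (t *\<^sub>R x) = t * q x)"

lemma sublinear_zero: assumes "sublinear q" shows "q 0 = 0"
proof -
  have "q (2 *\<^sub>R 0) = 2 * q 0" using assms unfolding sublinear_def by (metis zero_less_numeral)
  then show ?thesis by simp
qed

lemma sublinear_scale_nonneg: assumes "sublinear q" "0 \<le> t" shows "q (t *\<^sub>R x) = t * q x"
  using assms sublinear_zero[of q] by (cases "t = 0") (auto simp: sublinear_def)

lemma sublinear_minus: assumes "sublinear q" shows "- q (- x) \<le> q x"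
proof -
  have "q (x + - x) \<le> q x + q (- x)" using assms unfolding sublinear_def by blast
  with sublinear_zero[OF assms] show ?thesis by simp
qed

text \<open>
  Common form of three infima: over a chain of sublinear functions, over \<open>t \<ge> 0\<close>, and over a
  convex cone. In the last two the members are not sublinear; it is enough that sums and multiples
  of members dominate other members.
\<close>

lemma sublinear_Inf:
  fixes g :: "'i \<Rightarrow> 'a::real_vector \<Rightarrow> real"
  assumes ne: "I \<noteq> {}" and bdd: "\<And>x. \<exists>b. \<forall>i\<in>I. b \<le> g i x"
    and add: "\<And>i j x y. \<lbrakk>i \<in> I; j \<in> I\<rbrakk> \<Longrightarrow> \<exists>k\<in>I. g k (x + y) \<le> g i x + g j y"
    and scale: "\<And>i t x. \<lbrakk>i \<in> I; 0 < t\<rbrakk> \<Longrightarrow> \<exists>k\<in>I. g k (t *\<^sub>R x) \<le> t * g i x"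
  shows "sublinear (\<lambda>x. INF i\<in>I. g i x)"
proof -
  define p where "p x = (INF i\<in>I. g i x)" for x
  have lower: "p x \<le> g i x" if "i \<in> I" for i x
    unfolding p_def using bdd[of x] that by (intro cINF_lower) (auto simp: bdd_below_def)
  have greatest: "b \<le> p x" if "\<And>i. i \<in> I \<Longrightarrow> b \<le> g i x" for b x
    unfolding p_def using ne that by (intro cINF_greatest) auto
  have "p (x + y) \<le> p x + p y" for x y
  proof -
    have "p (x + y) - g j y \<le> p x" if j: "j \<in> I" for j
    proof (rule greatest)
      fix i assume "i \<in> I"
      then obtain k where "k \<in> I" "g k (x + y) \<le> g i x + g j y" using add j by blast
      with lower[of k "x + y"] show "p (x + y) - g j y \<le> g i x" by linarith
    qed
    then have "p (x + y) - p x \<le> p y" by (intro greatest) (smt (verit))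
    then show ?thesis by linarith
  qed
  moreover have le: "p (t *\<^sub>R x) \<le> t * p x" if t: "0 < t" for t x
  proof -
    have "p (t *\<^sub>R x) / t \<le> p x"
    proof (rule greatest)
      fix i assume "i \<in> I"
      then obtain k where "k \<in> I" "g k (t *\<^sub>R x) \<le> t * g i x" using scale t by blast
      with lower[of k "t *\<^sub>R x"] show "p (t *\<^sub>R x) / t \<le> g i x"
        using t by (simp add: field_simps)
    qed
    with t show ?thesis by (simp add: field_simps)
  qed
  moreover have "t * p x \<le> p (t *\<^sub>R x)" if t: "0 < t" for t x
    using le[of "1 / t" "t *\<^sub>R x"] t by (simp add: field_simps)
  ultimately show ?thesis unfolding sublinear_def p_def[symmetric] by (meson order_antisym)
qed

text \<open>
  A minimal sublinear function below \<open>q\<close> is linear: otherwise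
  \<open>INF t\<ge>0. p (x + t y) - t p y\<close> would be a smaller one.
\<close>

theorem hahn_banach:
  fixes q :: "'a::real_vector \<Rightarrow> real"
  assumes q: "sublinear q"
  obtains L where "linear L" "\<And>x. L x \<le> q x"
proof -
  define P where "P = {p. sublinear p \<and> (\<forall>x. p x \<le> q x)}"
  define R where "R p p' \<longleftrightarrow> (\<forall>x. p' x \<le> p x)" for p p' :: "'a \<Rightarrow> real"
  have lower: "- q (- x) \<le> p x" if "p \<in> P" for p x
    using that sublinear_minus[of p x] unfolding P_def by (smt (verit) mem_Collect_eq)
  have "\<exists>p\<in>P. \<forall>p'\<in>P. R p p' \<longrightarrow> p' = p"
  proof (rule predicate_Zorn)
    show "partial_order_on P (relation_of R P)"
    proof (rule partial_order_on_relation_ofI)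
      show "R p p''" if "R p p'" "R p' p''" for p p' p''
        using that unfolding R_def by (meson order_trans)
      show "p = p'" if "R p p'" "R p' p" for p p'
        using that unfolding R_def by (intro ext order_antisym) auto
    qed (auto simp: R_def)
    fix C assume C: "C \<in> Chains (relation_of R P)"
    have CP: "C \<subseteq> P" using C by (auto simp: Chains_def relation_of_def)
    have chain: "R p p' \<or> R p' p" if "p \<in> C" "p' \<in> C" for p p'
      using C that by (auto simp: Chains_def relation_of_def)
    show "\<exists>u\<in>P. \<forall>p\<in>C. R p u"
    proof (cases "C = {}")
      case True
      then show ?thesis using q by (auto simp: P_def)
    next
      case False
      define u where "u x = (INF p\<in>C. p x)" for x
      have bdd: "bdd_below ((\<lambda>p. p x) ` C)" for x
        using lower CP by (intro bdd_belowI2[where m = "- q (- x)"]) auto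
      have low: "u x \<le> p x" if "p \<in> C" for p x
        unfolding u_def by (rule cINF_lower[OF bdd that])
      have "sublinear (\<lambda>x. INF p\<in>C. p x)"
      proof (rule sublinear_Inf[OF False])
        show "\<exists>b. \<forall>p\<in>C. b \<le> p x" for x using lower CP by blast
        show "\<exists>k\<in>C. k (x + y) \<le> p x + p' y" if pp: "p \<in> C" "p' \<in> C" for p p' x y
          using chain[OF pp]
        proof
          assume "R p p'"
          then show ?thesis using pp CP unfolding R_def P_def sublinear_def
            by (intro bexI[of _ p']) (smt (verit) mem_Collect_eq subsetD)+
        next
          assume "R p' p"
          then show ?thesis using pp CP unfolding R_def P_def sublinear_def
            by (intro bexI[of _ p]) (smt (verit) mem_Collect_eq subsetD)+
        qed
        show "\<exists>k\<in>C. k (t *\<^sub>R x) \<le> t * p x" if "p \<in> C" "0 < t" for p t x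
          using that CP by (intro bexI[of _ p]) (auto simp: P_def sublinear_def subset_iff)
      qed
      moreover have "u x \<le> q x" for x
      proof -
        from False obtain p where "p \<in> C" by blast
        with low[of p x] CP show ?thesis unfolding P_def by (smt (verit) mem_Collect_eq subsetD)
      qed
      ultimately have "u \<in> P" by (simp add: P_def u_def[abs_def])
      with low show ?thesis by (auto simp: R_def)
    qed
  qed
  then obtain p where p: "p \<in> P" and minimal: "\<And>p'. \<lbrakk>p' \<in> P; R p p'\<rbrakk> \<Longrightarrow> p' = p" by blast
  have sub: "sublinear p" and pq: "\<And>x. p x \<le> q x" using p by (auto simp: P_def)
  have padd: "p (x + y) \<le> p x + p y" for x y using sub by (simp add: sublinear_def)
  have pscale: "p (t *\<^sub>R x) = t * p x" if "0 \<le> t" for t x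
    using sublinear_scale_nonneg[OF sub that] .
  have super: "p x + p y \<le> p (x + y)" for x y
  proof -
    define p' where "p' x = (INF t\<in>{0::real..}. p (x + t *\<^sub>R y) - t * p y)" for x
    have low: "- p (- x) \<le> p (x + t *\<^sub>R y) - t * p y" if "0 \<le> t" for t x
      using padd[of "x + t *\<^sub>R y" "- x"] pscale[OF that, of y] by simp
    have "sublinear p'"
      unfolding p'_def
    proof (rule sublinear_Inf)
      show "\<exists>b. \<forall>t\<in>{0..}. b \<le> p (x + t *\<^sub>R y) - t * p y" for x using low by auto
      show "\<exists>k\<in>{0..}. p (x + x' + k *\<^sub>R y) - k * p y \<le> p (x + t *\<^sub>R y) - t * p y + (p (x' + t' *\<^sub>R y) - t' * p y)"
        if "t \<in> {0..}" "t' \<in> {0..}" for t t' x x'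
        using padd[of "x + t *\<^sub>R y" "x' + t' *\<^sub>R y"] that
        by (intro bexI[of _ "t + t'"]) (auto simp: algebra_simps)
      show "\<exists>k\<in>{0..}. p (s *\<^sub>R x + k *\<^sub>R y) - k * p y \<le> s * (p (x + t *\<^sub>R y) - t * p y)"
        if "t \<in> {0..}" "0 < s" for s t x
        using pscale[of s "x + t *\<^sub>R y"] that
        by (intro bexI[of _ "s * t"]) (auto simp: algebra_simps)
    qed auto
    have le: "p' x \<le> p (x + t *\<^sub>R y) - t * p y" if "0 \<le> t" for t x
      unfolding p'_def using low that by (intro cINF_lower bdd_belowI2) auto
    have "R p p'" unfolding R_def using le[of 0] by simp
    moreover from this have "p' \<in> P"
      using \<open>sublinear p'\<close> pq unfolding P_def R_def by (blast intro: order_trans)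
    ultimately have "p' = p" by (intro minimal)
    with le[of 1 x] show ?thesis by simp
  qed
  have add: "p (x + y) = p x + p y" for x y using padd super by (intro order_antisym)
  have neg: "p (- x) = - p x" for x
    using add[of x "- x"] sublinear_zero[OF sub] by simp
  have "linear p"
  proof (rule linearI)
    fix t :: real and x
    show "p (t *\<^sub>R x) = t *\<^sub>R p x"
    proof (cases "0 \<le> t")
      case False
      then have "p (- (- t *\<^sub>R x)) = - (- t * p x)" by (subst neg) (subst pscale, auto)
      then show ?thesis by simp
    qed (simp add: pscale)
  qed (rule add)
  from this pq show thesis by (rule that)
qed

text \<open>
  The functional is obtained from the sublinear function \<open>INF (d, r)\<in>T. r + k (d + x)\<close>: the
  index \<open>0\<close> shows that it lies below \<open>k\<close>, and the index \<open>(d, r)\<close> at \<open>x = -d\<close> that it respects the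
  cone.
\<close>

lemma sublinear_cone_sandwich:
  fixes k :: "'a::real_normed_vector \<Rightarrow> real" and T :: "('a \<times> real) set"
  assumes k: "sublinear k" and C: "\<And>x. k x \<le> C * norm x"
    and T0: "(0, 0) \<in> T"
    and Tadd: "\<And>d r d' r'. \<lbrakk>(d, r) \<in> T; (d', r') \<in> T\<rbrakk> \<Longrightarrow> (d + d', r + r') \<in> T"
    and Tscale: "\<And>d r t. \<lbrakk>(d, r) \<in> T; 0 < t\<rbrakk> \<Longrightarrow> (t *\<^sub>R d, t * r) \<in> T"
    and nonneg: "\<And>d r. (d, r) \<in> T \<Longrightarrow> 0 \<le> r + k d"
  obtains L :: "'a \<Rightarrow>\<^sub>L real" where "\<And>x. L x \<le> k x" "\<And>d r. (d, r) \<in> T \<Longrightarrow> - L d \<le> r"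
proof -
  have kadd: "k (x + y) \<le> k x + k y" for x y using k by (simp add: sublinear_def)
  define g where "g z x = snd z + k (fst z + x)" for z :: "'a \<times> real" and x
  define q where "q x = (INF z\<in>T. g z x)" for x
  have low: "- k (- x) \<le> g z x" if "z \<in> T" for z x
    using nonneg[of "fst z" "snd z"] that kadd[of "fst z + x" "- x"] by (simp add: g_def)
  have "sublinear (\<lambda>x. INF z\<in>T. g z x)"
  proof (rule sublinear_Inf)
    show "T \<noteq> {}" using T0 by blast
    show "\<exists>b. \<forall>z\<in>T. b \<le> g z x" for x using low by blast
    show "\<exists>w\<in>T. g w (x + y) \<le> g z x + g z' y" if "z \<in> T" "z' \<in> T" for z z' x y
      using that kadd[of "fst z + x" "fst z' + y"] Tadd[of "fst z" "snd z" "fst z'" "snd z'"]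
      by (intro bexI[of _ "z + z'"]) (auto simp: g_def algebra_simps plus_prod_def)
    show "\<exists>w\<in>T. g w (t *\<^sub>R x) \<le> t * g z x" if "z \<in> T" "0 < t" for z t x
      using that sublinear_scale_nonneg[OF k, of t "fst z + x"] Tscale[of "fst z" "snd z" t]
      by (intro bexI[of _ "t *\<^sub>R z"]) (auto simp: g_def algebra_simps scaleR_prod_def)
  qed
  then have "sublinear q" by (simp add: q_def[abs_def])
  then obtain L where L: "linear L" "\<And>x. L x \<le> q x" using hahn_banach by blast
  have q: "q x \<le> g z x" if "z \<in> T" for z x
    unfolding q_def using low that by (intro cINF_lower bdd_belowI2) auto
  have Lk: "L x \<le> k x" for x using L(2)[of x] q[OF T0, of x] by (simp add: g_def)
  have "norm (L x) \<le> norm x * C" for x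
    using Lk[of x] Lk[of "- x"] C[of x] C[of "- x"] linear_neg[OF L(1), of x]
    by (simp add: abs_le_iff mult.commute)
  then have "bounded_linear L"
    using L(1) by (intro bounded_linear_intro[where K = C]) (auto simp: linear_add linear_scale)
  then have app: "blinfun_apply (Blinfun L) = L" by (rule bounded_linear_Blinfun_apply)
  show thesis
  proof
    show "blinfun_apply (Blinfun L) x \<le> k x" for x using Lk app by simp
    show "- blinfun_apply (Blinfun L) d \<le> r" if "(d, r) \<in> T" for d r
    proof -
      have "L (- d) \<le> r"
        using L(2)[of "- d"] q[OF that, of "- d"] sublinear_zero[OF k] by (simp add: g_def)
      then show ?thesis using app linear_neg[OF L(1)] by simp
    qed
  qed
qed


section \<open>Clarke tangent cones and the Clarke subdifferential\<close>

lemma clarke_tangentI: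
  assumes "\<And>zs t. \<lbrakk>\<And>k. zs k \<in> \<Omega>; zs \<longlonglongrightarrow> z; \<And>k. 0 < t k; t \<longlonglongrightarrow> 0\<rbrakk> \<Longrightarrow>
    \<exists>ds. ds \<longlonglongrightarrow> d \<and> (\<forall>k. zs k + t k *\<^sub>R ds k \<in> \<Omega>)"
  shows "d \<in> clarke_tangent \<Omega> z"
  unfolding clarke_tangent_def using assms by simp

lemma clarke_tangentE:
  assumes "d \<in> clarke_tangent \<Omega> z" "\<And>k. zs k \<in> \<Omega>" "zs \<longlonglongrightarrow> z" "\<And>k. 0 < t k" "t \<longlonglongrightarrow> 0"
  obtains ds where "ds \<longlonglongrightarrow> d" "\<And>k. zs k + t k *\<^sub>R ds k \<in> \<Omega>"
  using assms unfolding clarke_tangent_def by (smt (verit) mem_Collect_eq)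

lemma zero_in_clarke_tangent: "0 \<in> clarke_tangent \<Omega> z"
  by (rule clarke_tangentI) (auto intro!: exI[of _ "\<lambda>_. 0"])

lemma clarke_tangent_scale:
  assumes d: "d \<in> clarke_tangent \<Omega> z" and s: "0 < s"
  shows "s *\<^sub>R d \<in> clarke_tangent \<Omega> z"
proof (rule clarke_tangentI)
  fix zs and t :: "nat \<Rightarrow> real"
  assume zs: "\<And>k. zs k \<in> \<Omega>" "zs \<longlonglongrightarrow> z" and t: "\<And>k. 0 < t k" "t \<longlonglongrightarrow> 0"
  have ts: "0 < t k * s" "(\<lambda>k. t k * s) \<longlonglongrightarrow> 0" for k
    using t s tendsto_mult_left_zero by auto
  obtain ds where ds: "ds \<longlonglongrightarrow> d" "\<And>k. zs k + (t k * s) *\<^sub>R ds k \<in> \<Omega>"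
    by (rule clarke_tangentE[OF d zs ts]) blast
  have "(\<lambda>k. s *\<^sub>R ds k) \<longlonglongrightarrow> s *\<^sub>R d" by (intro tendsto_intros ds)
  with ds(2) show "\<exists>ds. ds \<longlonglongrightarrow> s *\<^sub>R d \<and> (\<forall>k. zs k + t k *\<^sub>R ds k \<in> \<Omega>)"
    by (intro exI[of _ "\<lambda>k. s *\<^sub>R ds k"]) simp
qed

text \<open>
  Uniformity in the base point is what makes Clarke's cone convex: the direction \<open>d'\<close> can be
  applied at the points already displaced along \<open>d\<close>.
\<close>

lemma clarke_tangent_add:
  assumes d: "d \<in> clarke_tangent \<Omega> z" and d': "d' \<in> clarke_tangent \<Omega> z"
  shows "d + d' \<in> clarke_tangent \<Omega> z"
proof (rule clarke_tangentI)
  fix zs and t :: "nat \<Rightarrow> real"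
  assume zs: "\<And>k. zs k \<in> \<Omega>" "zs \<longlonglongrightarrow> z" and t: "\<And>k. 0 < t k" "t \<longlonglongrightarrow> 0"
  obtain ds where ds: "ds \<longlonglongrightarrow> d" "\<And>k. zs k + t k *\<^sub>R ds k \<in> \<Omega>"
    by (rule clarke_tangentE[OF d zs t]) blast
  have "(\<lambda>k. zs k + t k *\<^sub>R ds k) \<longlonglongrightarrow> z + 0 *\<^sub>R d" by (intro tendsto_intros zs t ds)
  then have ws: "(\<lambda>k. zs k + t k *\<^sub>R ds k) \<longlonglongrightarrow> z" by simp
  obtain ds' where ds': "ds' \<longlonglongrightarrow> d'" "\<And>k. zs k + t k *\<^sub>R ds k + t k *\<^sub>R ds' k \<in> \<Omega>"
    by (rule clarke_tangentE[OF d' ds(2) ws t]) blast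
  have "(\<lambda>k. ds k + ds' k) \<longlonglongrightarrow> d + d'" by (intro tendsto_intros ds ds')
  with ds'(2) show "\<exists>ds. ds \<longlonglongrightarrow> d + d' \<and> (\<forall>k. zs k + t k *\<^sub>R ds k \<in> \<Omega>)"
    by (intro exI[of _ "\<lambda>k. ds k + ds' k"]) (simp add: scaleR_add_right add.assoc)
qed

text \<open>
  Specialization of the tangency condition to the constant base sequence; this is the only
  consequence of tangency that the sum rule uses besides the tangent vectors forming a convex cone.
\<close>

lemma clarke_tangent_epi_curve:
  assumes T: "(d, r) \<in> clarke_tangent (eepi \<phi>) (z, fz)" and z: "\<phi> z = ereal fz"
  obtains ds rs where "ds \<longlonglongrightarrow> d" "rs \<longlonglongrightarrow> r"
    "\<And>k. \<phi> (z + inverse (real (Suc k)) *\<^sub>R ds k) \<le> ereal (fz + inverse (real (Suc k)) * rs k)"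
proof -
  have inv: "0 < inverse (real (Suc k))" "(\<lambda>k. inverse (real (Suc k))) \<longlonglongrightarrow> 0" for k
    by (simp, rule LIMSEQ_inverse_real_of_nat)
  have zs: "(z, fz) \<in> eepi \<phi>" using z by (simp add: eepi_def)
  obtain ds where ds: "ds \<longlonglongrightarrow> (d, r)"
    "\<And>k. (z, fz) + inverse (real (Suc k)) *\<^sub>R ds k \<in> eepi \<phi>"
    by (rule clarke_tangentE[OF T zs tendsto_const inv]) blast
  show thesis
  proof (rule that)
    show "(\<lambda>k. fst (ds k)) \<longlonglongrightarrow> d" "(\<lambda>k. snd (ds k)) \<longlonglongrightarrow> r"
      using tendsto_fst[OF ds(1)] tendsto_snd[OF ds(1)] by auto
    show "\<phi> (z + inverse (real (Suc k)) *\<^sub>R fst (ds k))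
        \<le> ereal (fz + inverse (real (Suc k)) * snd (ds k))" for k
      using ds(2)[of k] by (simp add: eepi_def case_prod_beta)
  qed
qed

text \<open>
  Moving along tangent directions \<open>(d1, r1)\<close> and \<open>(d2, r2)\<close> of the two epigraphs cannot
  decrease the penalized sum, so \<open>r1 + r2 + k (d1, d2) \<ge> 0\<close> for the sublinear penalty \<open>k\<close>. The
  sandwich theorem separates the product of the tangent cones from \<open>k\<close> by a functional whose
  two negated components are the subgradients. On the diagonal the coupling term with the large
  factor \<open>\<gamma>\<close> vanishes, which bounds the norm of their sum by \<open>2 * c\<close>.
\<close>

lemma clarke_fuzzy_sum:
  fixes \<phi>1 \<phi>2 :: "'a::real_normed_vector \<Rightarrow> ereal"
  assumes fin: "\<phi>1 z1 = ereal f1" "\<phi>2 z2 = ereal f2"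
    and \<gamma>: "0 \<le> \<gamma>" and c: "0 \<le> c" and s: "0 < s"
    and min: "\<And>u1 u2 r1 r2. \<lbrakk>norm (u1 - z1) < s; norm (u2 - z2) < s; \<phi>1 u1 \<le> ereal r1; \<phi>2 u2 \<le> ereal r2\<rbrakk> \<Longrightarrow>
      f1 + f2 \<le> r1 + r2 + \<gamma> * norm ((u1 - z1) - (u2 - z2)) + c * norm (u1 - z1) + c * norm (u2 - z2)"
  obtains a b where "a \<in> clarke_subdiff \<phi>1 z1" "b \<in> clarke_subdiff \<phi>2 z2" "norm (a + b) \<le> 2 * c"
proof -
  define T1 where "T1 = clarke_tangent (eepi \<phi>1) (z1, f1)"
  define T2 where "T2 = clarke_tangent (eepi \<phi>2) (z2, f2)"
  define k where "k p = \<gamma> * norm (fst p - snd p) + c * norm (fst p) + c * norm (snd p)" for p :: "'a \<times> 'a"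
  define T where "T = (\<lambda>(p, q). ((fst p, fst q), snd p + snd q)) ` (T1 \<times> T2)"
  have T_I: "((d1, d2), r1 + r2) \<in> T" if "(d1, r1) \<in> T1" "(d2, r2) \<in> T2" for d1 d2 r1 r2
    unfolding T_def using that by (intro image_eqI[of _ _ "((d1, r1), (d2, r2))"]) auto
  have o: "(0, 0) \<in> T1" "(0, 0) \<in> T2"
    using zero_in_clarke_tangent[of "eepi \<phi>1" "(z1, f1)"] zero_in_clarke_tangent[of "eepi \<phi>2" "(z2, f2)"]
    by (simp_all add: T1_def T2_def zero_prod_def)
  have nonneg: "0 \<le> r1 + r2 + k (d1, d2)" if d12: "(d1, r1) \<in> T1" "(d2, r2) \<in> T2" for d1 r1 d2 r2
  proof -
    obtain ds1 rs1 where 1: "ds1 \<longlonglongrightarrow> d1" "rs1 \<longlonglongrightarrow> r1"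
      "\<And>n. \<phi>1 (z1 + inverse (real (Suc n)) *\<^sub>R ds1 n) \<le> ereal (f1 + inverse (real (Suc n)) * rs1 n)"
      by (rule clarke_tangent_epi_curve[OF d12(1)[unfolded T1_def] fin(1)]) blast
    obtain ds2 rs2 where 2: "ds2 \<longlonglongrightarrow> d2" "rs2 \<longlonglongrightarrow> r2"
      "\<And>n. \<phi>2 (z2 + inverse (real (Suc n)) *\<^sub>R ds2 n) \<le> ereal (f2 + inverse (real (Suc n)) * rs2 n)"
      by (rule clarke_tangent_epi_curve[OF d12(2)[unfolded T2_def] fin(2)]) blast
    have small: "\<forall>\<^sub>F n in sequentially. norm (inverse (real (Suc n)) *\<^sub>R ds n) < s"
      if "ds \<longlonglongrightarrow> d" for ds and d :: 'a
    proof -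
      have "(\<lambda>n. norm (inverse (real (Suc n)) *\<^sub>R ds n)) \<longlonglongrightarrow> norm (0 *\<^sub>R d)"
        by (intro tendsto_intros LIMSEQ_inverse_real_of_nat that)
      then show ?thesis using s by (intro order_tendstoD) auto
    qed
    have "\<forall>\<^sub>F n in sequentially. 0 \<le> rs1 n + rs2 n + k (ds1 n, ds2 n)"
      using small[OF 1(1)] small[OF 2(1)]
    proof eventually_elim
      case (elim n)
      define t where "t = inverse (real (Suc n))"
      have t: "0 < t" by (simp add: t_def)
      have "f1 + f2 \<le> f1 + t * rs1 n + (f2 + t * rs2 n) + \<gamma> * norm (t *\<^sub>R ds1 n - t *\<^sub>R ds2 n)
          + c * norm (t *\<^sub>R ds1 n) + c * norm (t *\<^sub>R ds2 n)"
        using min[of "z1 + t *\<^sub>R ds1 n" "z2 + t *\<^sub>R ds2 n" "f1 + t * rs1 n" "f2 + t * rs2 n"]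
          elim 1(3)[of n] 2(3)[of n] unfolding t_def by simp
      also have "norm (t *\<^sub>R ds1 n - t *\<^sub>R ds2 n) = t * norm (ds1 n - ds2 n)"
        using t by (simp flip: scaleR_diff_right)
      finally have "0 \<le> t * (rs1 n + rs2 n + k (ds1 n, ds2 n))"
        using t by (simp add: k_def algebra_simps)
      with t show ?case by (simp add: zero_le_mult_iff)
    qed
    moreover have "(\<lambda>n. rs1 n + rs2 n + k (ds1 n, ds2 n)) \<longlonglongrightarrow> r1 + r2 + k (d1, d2)"
      unfolding k_def fst_conv snd_conv by (intro tendsto_intros 1 2)
    ultimately show ?thesis by (intro tendsto_lowerbound) auto
  qed
  have sub: "sublinear k"
    unfolding sublinear_def
  proof (intro conjI allI impI)
    fix x y :: "'a \<times> 'a"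
    have "norm (fst (x + y) - snd (x + y)) \<le> norm (fst x - snd x) + norm (fst y - snd y)"
      using norm_triangle_ineq[of "fst x - snd x" "fst y - snd y"] by (simp add: algebra_simps)
    then show "k (x + y) \<le> k x + k y"
      using mult_left_mono[OF _ \<gamma>] mult_left_mono[OF norm_triangle_ineq c, of "fst x" "fst y"]
        mult_left_mono[OF norm_triangle_ineq c, of "snd x" "snd y"]
      unfolding k_def by (fastforce simp: distrib_left)
  next
    fix t :: real and x :: "'a \<times> 'a" assume "0 < t"
    then show "k (t *\<^sub>R x) = t * k x"
      by (simp add: k_def distrib_left mult.left_commute flip: scaleR_diff_right)
  qed
  have bound: "k x \<le> (2 * \<gamma> + 2 * c) * norm x" for x
  proof -
    have n: "norm (fst x) \<le> norm x" "norm (snd x) \<le> norm x"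
      using norm_fst_le[of "fst x" "snd x"] norm_snd_le[of "snd x" "fst x"] by auto
    then have "norm (fst x - snd x) \<le> 2 * norm x"
      using norm_triangle_ineq4[of "fst x" "snd x"] by linarith
    then have "\<gamma> * norm (fst x - snd x) \<le> \<gamma> * (2 * norm x)" using \<gamma> by (intro mult_left_mono)
    moreover have "c * norm (fst x) \<le> c * norm x" "c * norm (snd x) \<le> c * norm x"
      using n c by (auto intro: mult_left_mono)
    ultimately show ?thesis by (simp add: k_def algebra_simps)
  qed
  obtain L where Lk: "\<And>x. blinfun_apply L x \<le> k x" and LT: "\<And>d r. (d, r) \<in> T \<Longrightarrow> - L d \<le> r"
  proof (rule sublinear_cone_sandwich[OF sub bound, of T])
    from T_I[OF o] show "(0, 0) \<in> T" by (simp add: zero_prod_def)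
    show "(d + d', r + r') \<in> T" if "(d, r) \<in> T" "(d', r') \<in> T" for d r d' r'
    proof -
      from that obtain d1 d2 r1 r2 d1' d2' r1' r2' where e: "d = (d1, d2)" "r = r1 + r2" "d' = (d1', d2')" "r' = r1' + r2'"
        and m: "(d1, r1) \<in> T1" "(d2, r2) \<in> T2" "(d1', r1') \<in> T1" "(d2', r2') \<in> T2"
        by (auto simp: T_def)
      have "(d1 + d1', r1 + r1') \<in> T1" "(d2 + d2', r2 + r2') \<in> T2"
        using clarke_tangent_add m unfolding T1_def T2_def by fastforce+
      from T_I[OF this] show ?thesis by (simp add: e algebra_simps)
    qed
    show "(t *\<^sub>R d, t * r) \<in> T" if "(d, r) \<in> T" "0 < t" for d r t
    proof -
      from that obtain d1 d2 r1 r2 where e: "d = (d1, d2)" "r = r1 + r2"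
        and m: "(d1, r1) \<in> T1" "(d2, r2) \<in> T2" by (auto simp: T_def)
      have "(t *\<^sub>R d1, t * r1) \<in> T1" "(t *\<^sub>R d2, t * r2) \<in> T2"
        using clarke_tangent_scale[OF _ that(2)] m unfolding T1_def T2_def by fastforce+
      from T_I[OF this] show ?thesis by (simp add: e algebra_simps)
    qed
    show "0 \<le> r + k d" if "(d, r) \<in> T" for d r
      using that nonneg by (auto simp: T_def)
  qed blast
  have bl: "bounded_linear (\<lambda>u. - L (u, 0))" "bounded_linear (\<lambda>u. - L (0, u))"
    by (intro bounded_linear_minus bounded_linear_compose[OF blinfun.bounded_linear_right]
        bounded_linear_Pair bounded_linear_ident bounded_linear_zero)+
  define a b where "a = Blinfun (\<lambda>u. - L (u, 0))" and "b = Blinfun (\<lambda>u. - L (0, u))"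
  have app: "blinfun_apply a u = - L (u, 0)" "blinfun_apply b u = - L (0, u)" for u
    using bl by (auto simp: a_def b_def bounded_linear_Blinfun_apply)
  show thesis
  proof (rule that)
    have "blinfun_apply a d \<le> r" if "(d, r) \<in> T1" for d r
      using LT[OF T_I[OF that o(2)]] by (simp add: app)
    then show "a \<in> clarke_subdiff \<phi>1 z1"
      by (auto simp: clarke_subdiff_def clarke_normal_def edom_def fin T1_def blinfun.diff_left)
    have "blinfun_apply b d \<le> r" if "(d, r) \<in> T2" for d r
      using LT[OF T_I[OF o(1) that]] by (simp add: app)
    then show "b \<in> clarke_subdiff \<phi>2 z2"
      by (auto simp: clarke_subdiff_def clarke_normal_def edom_def fin T2_def blinfun.diff_left)
    have "(a + b) u = L (- u, - u)" for u
    proof -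
      have "(a + b) u = - L ((u, 0) + (0, u))" by (simp only: blinfun.add_left app blinfun.add_right)
      then show ?thesis by (simp flip: blinfun.minus_right)
    qed
    then have le: "(a + b) u \<le> 2 * c * norm u" for u
      using Lk[of "(- u, - u)"] by (simp add: k_def)
    have "norm ((a + b) u) \<le> 2 * c * norm u" for u
      using le[of u] le[of "- u"] by (simp add: blinfun.minus_right abs_le_iff)
    then show "norm (a + b) \<le> 2 * c" using c by (intro norm_blinfun_bound) auto
  qed
qed


section \<open>Almost supports of Lipschitz functions on Asplund spaces\<close>

text \<open>
  One of the two halves of a segment is at least as steep as the whole, so repeated halving
  makes the segment arbitrarily short without loss of steepness.
\<close>

lemma steep_subsegment:
  fixes V :: "'a::real_normed_vector \<Rightarrow> real"
  assumes "0 < t" "norm x \<le> R" "norm (x + t *\<^sub>R d) \<le> R" and \<tau>: "0 < \<tau>"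
  obtains x' t' where "0 < t'" "t' < \<tau>" "norm x' \<le> R" "norm (x' + t' *\<^sub>R d) \<le> R"
    "(V (x + t *\<^sub>R d) - V x) / t \<le> (V (x' + t' *\<^sub>R d) - V x') / t'"
proof -
  define s where "s = (V (x + t *\<^sub>R d) - V x) / t"
  have halve: "\<exists>x'. norm x' \<le> R \<and> norm (x' + (t / 2 ^ n) *\<^sub>R d) \<le> R \<and>
          (t / 2 ^ n) * s \<le> V (x' + (t / 2 ^ n) *\<^sub>R d) - V x'" for n
  proof (induction n)
    case 0
    show ?case using assms by (intro exI[of _ x]) (simp add: s_def)
  next
    case (Suc n)
    define h where "h = t / 2 ^ Suc n"
    have h2: "t / 2 ^ n = 2 * h" by (simp add: h_def)
    from Suc obtain x' where x': "norm x' \<le> R" "norm (x' + (2 * h) *\<^sub>R d) \<le> R"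
      "(2 * h) * s \<le> V (x' + (2 * h) *\<^sub>R d) - V x'" unfolding h2 by blast
    define m where "m = x' + h *\<^sub>R d"
    have endpt: "m + h *\<^sub>R d = x' + (2 * h) *\<^sub>R d"
      by (simp add: m_def algebra_simps flip: scaleR_add_left)
    have "m = (1/2) *\<^sub>R x' + (1/2) *\<^sub>R (x' + (2 * h) *\<^sub>R d)"
      by (simp add: m_def algebra_simps flip: scaleR_add_left)
    then have "norm m \<le> (1/2) * norm x' + (1/2) * norm (x' + (2 * h) *\<^sub>R d)"
      by (metis (no_types, opaque_lifting) norm_triangle_ineq norm_scaleR abs_of_nonneg
          zero_le_divide_1_iff zero_le_numeral)
    with x' have m: "norm m \<le> R" by linarith
    consider "h * s \<le> V m - V x'" | "h * s \<le> V (m + h *\<^sub>R d) - V m"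
      using x'(3) unfolding endpt by linarith
    then show ?case
    proof cases
      case 1
      then show ?thesis unfolding h_def[symmetric] using x' m
        by (intro exI[of _ x']) (simp add: m_def)
    next
      case 2
      then show ?thesis unfolding h_def[symmetric] using x' m endpt
        by (intro exI[of _ m]) simp
    qed
  qed
  obtain n where "inverse 2 ^ n < \<tau> / t"
    using real_arch_pow_inv[of "\<tau> / t" "inverse 2"] \<tau> \<open>0 < t\<close> by auto
  then have n: "t / 2 ^ n < \<tau>" using \<open>0 < t\<close> by (simp add: field_simps)
  have pos: "0 < t / 2 ^ n" using \<open>0 < t\<close> by simp
  from halve[of n] obtain x' where x': "norm x' \<le> R" "norm (x' + (t / 2 ^ n) *\<^sub>R d) \<le> R"
    "(t / 2 ^ n) * s \<le> V (x' + (t / 2 ^ n) *\<^sub>R d) - V x'" by blast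
  have "s \<le> (V (x' + (t / 2 ^ n) *\<^sub>R d) - V x') / (t / 2 ^ n)"
    using x'(3) by (simp only: pos_le_divide_eq[OF pos] mult.commute)
  with that[OF pos n x'(1,2)] show thesis unfolding s_def by blast
qed

text \<open>
  This is where the Asplund property enters. The supremum \<open>m d\<close> of the difference quotients of
  \<open>V\<close> in direction \<open>d\<close> over all segments inside the ball is sublinear in \<open>d\<close>; subadditivity
  needs short segments away from the boundary, which \<open>steep_subsegment\<close> provides. At a point \<open>d0\<close> of
  Frechet differentiability of \<open>m\<close>, take a segment from \<open>x\<close> to \<open>y = x + t d0\<close> that is almost as
  steep as \<open>m d0\<close> allows. For \<open>u\<close> near \<open>x\<close> the bound \<open>V y - V u \<le> t m ((y - u) / t)\<close>, linearized at \<open>d0\<close>,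
  becomes a lower bound for \<open>V u\<close> that is affine up to an error small compared with the radius
  \<open>\<tau>\<close> on which it holds.
\<close>

lemma asplund_lipschitz_almost_support:
  fixes V :: "'a::banach \<Rightarrow> real"
  assumes asplund: "asplund TYPE('a)" and K: "0 \<le> K" and lip: "\<And>x y. V y - V x \<le> K * norm (y - x)"
    and \<rho>: "0 < \<rho>" and \<epsilon>: "0 < \<epsilon>"
  obtains x and a :: "'a \<Rightarrow>\<^sub>L real" and \<tau> where "norm x < \<rho>" "0 < \<tau>" "\<tau> < \<rho>" "norm a \<le> K"
    "\<And>u. norm (u - x) \<le> \<tau> \<Longrightarrow> V x + a (u - x) - \<epsilon> * \<tau> \<le> V u"
proof -
  define seg where "seg d = {(x, t). 0 < t \<and> norm x < \<rho> \<and> norm (x + t *\<^sub>R d) < \<rho>}" for d :: 'a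
  define sl where "sl d = (\<lambda>(x, t). (V (x + t *\<^sub>R d) - V x) / t)" for d :: 'a
  define m where "m d = (SUP p\<in>seg d. sl d p)" for d
  have ne: "seg d \<noteq> {}" for d
  proof -
    have "norm ((\<rho> / (2 * (norm d + 1))) *\<^sub>R d) < \<rho>"
    proof -
      have "norm d / (2 * (norm d + 1)) < 1" by (smt (verit) divide_less_eq_1 norm_ge_zero)
      then have "\<rho> * (norm d / (2 * (norm d + 1))) < \<rho> * 1"
        using \<rho> by (intro mult_strict_left_mono)
      then show ?thesis using \<rho> by (simp add: abs_of_pos add_nonneg_pos)
    qed
    moreover have "0 < \<rho> / (2 * (norm d + 1))"
      using \<rho> by (intro divide_pos_pos mult_pos_pos) (auto intro: add_nonneg_pos)
    ultimately have "(0, \<rho> / (2 * (norm d + 1))) \<in> seg d" using \<rho> by (simp add: seg_def)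
    then show ?thesis by blast
  qed
  have slK: "sl d p \<le> K * norm d" if "p \<in> seg d" for d p
  proof -
    obtain x t where p: "p = (x, t)" by fastforce
    with that have "0 < t" by (simp add: seg_def)
    with lip[of "x + t *\<^sub>R d" x] show ?thesis by (simp add: p sl_def field_simps)
  qed
  have bdd: "bdd_above (sl d ` seg d)" for d using slK by (intro bdd_aboveI2) auto
  have upper: "V (x + t *\<^sub>R d) - V x \<le> t * m d"
    if "0 < t" "norm x < \<rho>" "norm (x + t *\<^sub>R d) < \<rho>" for x t d
  proof -
    have "sl d (x, t) \<le> m d" unfolding m_def using that by (intro cSUP_upper bdd) (simp add: seg_def)
    with that show ?thesis by (simp add: sl_def field_simps)
  qed
  have least: "m d \<le> b" if "\<And>p. p \<in> seg d \<Longrightarrow> sl d p \<le> b" for d b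
    unfolding m_def using ne that by (intro cSUP_least) auto
  have mK: "m d \<le> K * norm d" for d by (rule least) (rule slK)
  have madd: "m (d + e) \<le> m d + m e" for d e
  proof (rule least)
    fix p assume "p \<in> seg (d + e)"
    then obtain x t where p: "p = (x, t)" "0 < t" "norm x < \<rho>" "norm (x + t *\<^sub>R (d + e)) < \<rho>"
      by (auto simp: seg_def)
    define R where "R = max (norm x) (norm (x + t *\<^sub>R (d + e)))"
    have R: "R < \<rho>" using p by (simp add: R_def)
    have pos: "0 < (\<rho> - R) / (norm d + 1)" using R by (intro divide_pos_pos) (auto intro: add_nonneg_pos)
    have Rx: "norm x \<le> R" "norm (x + t *\<^sub>R (d + e)) \<le> R" by (auto simp: R_def)
    obtain x' t' where x': "0 < t'" "t' < (\<rho> - R) / (norm d + 1)" "norm x' \<le> R"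
      "norm (x' + t' *\<^sub>R (d + e)) \<le> R"
      and sl: "(V (x + t *\<^sub>R (d + e)) - V x) / t \<le> (V (x' + t' *\<^sub>R (d + e)) - V x') / t'"
      using steep_subsegment[OF p(2) Rx pos, of V] by blast
    have "t' * norm d \<le> t' * (norm d + 1)" using x'(1) by simp
    also have "\<dots> < \<rho> - R" using x'(2) by (simp add: pos_less_divide_eq add_nonneg_pos)
    finally have "norm (x' + t' *\<^sub>R d) < \<rho>"
      using norm_triangle_ineq[of x' "t' *\<^sub>R d"] x'(1,3) by simp
    then have "V (x' + t' *\<^sub>R d) - V x' \<le> t' * m d"
      and "V (x' + t' *\<^sub>R d + t' *\<^sub>R e) - V (x' + t' *\<^sub>R d) \<le> t' * m e"
      using upper[OF x'(1), of x' d] upper[OF x'(1), of "x' + t' *\<^sub>R d" e] x' R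
      by (auto simp: algebra_simps)
    then have "V (x' + t' *\<^sub>R (d + e)) - V x' \<le> t' * (m d + m e)"
      by (simp add: algebra_simps)
    then have "(V (x' + t' *\<^sub>R (d + e)) - V x') / t' \<le> m d + m e"
      using x'(1) by (simp add: field_simps)
    with sl show "sl (d + e) p \<le> m d + m e" by (simp add: sl_def p(1))
  qed
  have mscale: "m (s *\<^sub>R d) \<le> s * m d" if s: "0 < s" for s d
  proof (rule least)
    fix p assume "p \<in> seg (s *\<^sub>R d)"
    then obtain x t where p: "p = (x, t)" "0 < t" "norm x < \<rho>" "norm (x + (t * s) *\<^sub>R d) < \<rho>"
      by (auto simp: seg_def)
    then show "sl (s *\<^sub>R d) p \<le> s * m d"
      using upper[of "t * s" x d] s by (simp add: sl_def field_simps)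
  qed
  have mlip: "m d - m e \<le> K * norm (d - e)" for d e
    using madd[of "d - e" e] mK[of "d - e"] by simp
  have "K-lipschitz_on UNIV m"
  proof (rule lipschitz_onI)
    show "dist (m x) (m y) \<le> K * dist x y" for x y
      using mlip[of x y] mlip[of y x] by (simp add: dist_norm abs_le_iff norm_minus_commute)
  qed (rule K)
  then have "continuous_on UNIV m" by (rule lipschitz_on_continuous_on)
  moreover have "convex_on UNIV m"
  proof (rule convex_onI)
    fix s :: real and x y :: 'a assume "0 < s" "s < 1"
    then show "m ((1 - s) *\<^sub>R x + s *\<^sub>R y) \<le> (1 - s) * m x + s * m y"
      using madd[of "(1 - s) *\<^sub>R x" "s *\<^sub>R y"] mscale[of s y] mscale[of "1 - s" x] by linarith
  qed simp
  ultimately have "UNIV \<subseteq> closure {x \<in> UNIV. m differentiable (at x)}"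
    using asplund unfolding asplund_def by (metis convex_UNIV open_UNIV)
  then have "closure {x \<in> UNIV. m differentiable (at x)} \<noteq> {}" by (metis UNIV_not_empty subset_empty)
  then obtain d0 D where D: "(m has_derivative D) (at d0)"
    by (auto simp: differentiable_def closure_eq_empty)
  define a where "a = Blinfun D"
  have bl: "bounded_linear D" using D by (rule has_derivative_bounded_linear)
  have aD: "blinfun_apply a = D" unfolding a_def using bl by (rule bounded_linear_Blinfun_apply)
  have D_approx: "\<exists>s>0. \<forall>w. norm w < s \<longrightarrow> \<bar>m (d0 + w) - m d0 - D w\<bar> \<le> e * norm w" if "0 < e" for e
  proof -
    from D that obtain s where "s > 0"
      "\<And>y. norm (y - d0) < s \<Longrightarrow> norm (m y - m d0 - D (y - d0)) \<le> e * norm (y - d0)"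
      unfolding has_derivative_at_alt by blast
    then show ?thesis
      by (intro exI[of _ s]) (metis add_diff_cancel_left' real_norm_def)
  qed
  have DK: "D e \<le> K * norm e" for e
  proof (cases "e = 0")
    case False
    show ?thesis
    proof (rule field_le_epsilon)
      fix b :: real assume b: "0 < b"
      with False have "0 < b / norm e" by simp
      from D_approx[OF this] obtain s where s: "s > 0"
        "\<And>w. norm w < s \<Longrightarrow> \<bar>m (d0 + w) - m d0 - D w\<bar> \<le> b / norm e * norm w" by blast
      define t where "t = s / (2 * norm e)"
      have t: "0 < t" "norm (t *\<^sub>R e) < s" using s(1) False by (auto simp: t_def field_simps)
      have "D (t *\<^sub>R e) \<le> m (d0 + t *\<^sub>R e) - m d0 + b / norm e * norm (t *\<^sub>R e)"
        using s(2)[OF t(2)] by linarith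
      also have "\<dots> \<le> t * (K * norm e) + t * b"
        using mlip[of "d0 + t *\<^sub>R e" d0] t(1) False
        by (simp add: mult.left_commute[of K])
      finally have "t * D e \<le> t * (K * norm e + b)"
        using linear_scale[OF bounded_linear.linear[OF bl], of t e] by (simp add: algebra_simps)
      with t(1) show "D e \<le> K * norm e + b" by (simp add: mult_le_cancel_left)
    qed
  qed (simp add: linear_0[OF bounded_linear.linear[OF bl]])
  have "norm (a e) \<le> K * norm e" for e
    using DK[of e] DK[of "- e"] linear_neg[OF bounded_linear.linear[OF bl], of e]
    by (simp add: aD abs_le_iff)
  then have aK: "norm a \<le> K" using K by (intro norm_blinfun_bound)
  obtain s where s: "0 < s" "\<And>w. norm w \<le> s \<Longrightarrow> m (d0 + w) \<le> m d0 + D w + \<epsilon> / 2 * s"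
  proof -
    obtain s where s: "0 < s"
      "\<And>w. norm w < s \<Longrightarrow> \<bar>m (d0 + w) - m d0 - D w\<bar> \<le> \<epsilon> / 2 * norm w"
      using D_approx[of "\<epsilon> / 2"] \<epsilon> by auto
    have "m (d0 + w) \<le> m d0 + D w + \<epsilon> / 2 * (s / 2)" if "norm w \<le> s / 2" for w
    proof -
      have "\<epsilon> / 2 * norm w \<le> \<epsilon> / 2 * (s / 2)" using that \<epsilon> by (intro mult_left_mono) auto
      with s(2)[of w] that s(1) show ?thesis by linarith
    qed
    with s(1) show thesis by (intro that[of "s / 2"]) auto
  qed
  have "m d0 - \<epsilon> / 2 * s < m d0" using \<epsilon> s by simp
  then have "\<exists>p\<in>seg d0. m d0 - \<epsilon> / 2 * s < sl d0 p"
    unfolding m_def using less_cSUP_iff[OF ne bdd] by blast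
  then obtain x0 t0 where x0: "0 < t0" "norm x0 < \<rho>" "norm (x0 + t0 *\<^sub>R d0) < \<rho>"
    and steep0: "m d0 - \<epsilon> / 2 * s < (V (x0 + t0 *\<^sub>R d0) - V x0) / t0"
    by (auto simp: seg_def sl_def)
  define R where "R = max (norm x0) (norm (x0 + t0 *\<^sub>R d0))"
  have R: "R < \<rho>" "0 \<le> R" using x0 by (auto simp: R_def le_max_iff_disj)
  have Rx: "norm x0 \<le> R" "norm (x0 + t0 *\<^sub>R d0) \<le> R" by (auto simp: R_def)
  have pos: "0 < (\<rho> - R) / s" using R s by simp
  obtain x t where x: "0 < t" "t < (\<rho> - R) / s" "norm x \<le> R" "norm (x + t *\<^sub>R d0) \<le> R"
    and sl: "(V (x0 + t0 *\<^sub>R d0) - V x0) / t0 \<le> (V (x + t *\<^sub>R d0) - V x) / t"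
    using steep_subsegment[OF x0(1) Rx pos, of V] by blast
  from steep0 sl have "m d0 - \<epsilon> / 2 * s < (V (x + t *\<^sub>R d0) - V x) / t" by linarith
  then have steep: "t * m d0 - \<epsilon> / 2 * (t * s) \<le> V (x + t *\<^sub>R d0) - V x"
    using x(1) by (simp add: field_simps)
  have ts: "0 < t * s" "t * s < \<rho> - R" using x(1,2) s(1) by (auto simp: pos_less_divide_eq)
  show thesis
  proof (rule that)
    show "norm x < \<rho>" "0 < t * s" "t * s < \<rho>" "norm a \<le> K" using x ts R aK by auto
    fix u assume u: "norm (u - x) \<le> t * s"
    define w where "w = (1 / t) *\<^sub>R (x - u)"
    have tw: "t *\<^sub>R w = x - u" using x(1) by (simp add: w_def)
    have "t * norm w \<le> t * s" using u x(1) tw by (metis abs_of_pos norm_minus_commute norm_scaleR)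
    then have w: "norm w \<le> s" using x(1) by simp
    have endpt: "u + t *\<^sub>R (d0 + w) = x + t *\<^sub>R d0" using tw by (simp add: algebra_simps)
    have "norm u < \<rho>" using u ts x(3) norm_triangle_sub[of u x] by linarith
    then have "V (x + t *\<^sub>R d0) - V u \<le> t * m (d0 + w)"
      using upper[OF x(1), of u "d0 + w"] x(4) R(1) unfolding endpt by simp
    also have "\<dots> \<le> t * (m d0 + D w + \<epsilon> / 2 * s)"
      using s(2)[OF w] x(1) by (intro mult_left_mono) auto
    also have "\<dots> = t * m d0 + D (x - u) + \<epsilon> / 2 * (t * s)"
      using linear_scale[OF bounded_linear.linear[OF bl], of t w] tw by (simp add: algebra_simps)
    finally have "V x - D (x - u) - \<epsilon> / 2 * (t * s) - \<epsilon> / 2 * (t * s) \<le> V u"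
      using steep by linarith
    moreover have "D (x - u) = - D (u - x)"
      using linear_neg[OF bounded_linear.linear[OF bl], of "u - x"] by simp
    ultimately show "V x + a (u - x) - \<epsilon> * (t * s) \<le> V u" by (simp add: aD field_simps)
  qed
qed

text \<open>
  The infimum of the family over \<open>v\<close> inherits the Lipschitz constant, and its lower estimate
  passes to all members of the family, at the price of a near-minimizing index. In the
  applications a variation of the parameter is compensated by a variation of the index.
\<close>

lemma asplund_marginal_almost_support:
  fixes W :: "'a::banach \<Rightarrow> 'v \<Rightarrow> real"
  assumes asplund: "asplund TYPE('a)" and K: "0 \<le> K"
    and lip: "\<And>v x y. v \<in> A \<Longrightarrow> W y v - W x v \<le> K * norm (y - x)"
    and ne: "A \<noteq> {}" and bdd: "\<And>v. v \<in> A \<Longrightarrow> b \<le> W 0 v"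
    and \<rho>: "0 < \<rho>" and \<epsilon>: "0 < \<epsilon>"
  obtains h v and a :: "'a \<Rightarrow>\<^sub>L real" and \<tau>
  where "norm h < \<rho>" "v \<in> A" "0 < \<tau>" "\<tau> < \<rho>" "norm a \<le> K"
    "\<And>w v'. \<lbrakk>norm w \<le> \<tau>; v' \<in> A\<rbrakk> \<Longrightarrow> W h v + a w - \<epsilon> * \<tau> \<le> W (h + w) v'"
proof -
  define V where "V x = (INF v\<in>A. W x v)" for x
  have "b - K * norm x \<le> W x v" if "v \<in> A" for x v
    using bdd[OF that] lip[OF that, of 0 x] by simp
  then have bd: "bdd_below (W x ` A)" for x by (intro bdd_belowI2) auto
  have lower: "V x \<le> W x v" if "v \<in> A" for x v unfolding V_def using bd that by (rule cINF_lower)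
  have Vlip: "V y - V x \<le> K * norm (y - x)" for x y
  proof -
    have "V y - K * norm (y - x) \<le> W x v" if "v \<in> A" for v
      using lower[OF that, of y] lip[OF that, of y x] by linarith
    then have "V y - K * norm (y - x) \<le> V x" unfolding V_def by (intro cINF_greatest ne)
    then show ?thesis by linarith
  qed
  have "0 < \<epsilon> / 2" using \<epsilon> by simp
  then obtain h a \<tau> where h: "norm h < \<rho>" "0 < \<tau>" "\<tau> < \<rho>" "norm a \<le> K"
    and supp: "\<And>u. norm (u - h) \<le> \<tau> \<Longrightarrow> V h + blinfun_apply a (u - h) - \<epsilon> / 2 * \<tau> \<le> V u"
    by (rule asplund_lipschitz_almost_support[OF asplund K Vlip \<rho>]) (blast intro: that)
  have "V h < V h + \<epsilon> / 2 * \<tau>" using \<epsilon> h by simp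
  then obtain v where v: "v \<in> A" "W h v < V h + \<epsilon> / 2 * \<tau>"
    unfolding V_def using cINF_less_iff[OF ne bd, of h "V h + \<epsilon> / 2 * \<tau>"] unfolding V_def by blast
  show thesis
  proof (rule that[OF h(1) v(1) h(2-4)])
    fix w :: 'a and v' assume "norm w \<le> \<tau>" and v': "v' \<in> A"
    then have "V h + a w - \<epsilon> / 2 * \<tau> \<le> V (h + w)" using supp[of "h + w"] by simp
    with v(2) lower[OF v', of "h + w"] show "W h v + a w - \<epsilon> * \<tau> \<le> W (h + w) v'" by linarith
  qed
qed


section \<open>From approximate to exact Frechet subgradients\<close>

text \<open>
  A local \<open>\<epsilon>\<close>-subgradient of Frechet type on the neighbourhood of radius \<open>s\<close>; the Frechet
  subgradients are the functionals that have this property for every \<open>\<epsilon> > 0\<close> with some \<open>s\<close>.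
\<close>

definition eps_support ::
  "'a::real_normed_vector set \<Rightarrow> ('a \<Rightarrow> real) \<Rightarrow> 'a \<Rightarrow> ('a \<Rightarrow>\<^sub>L real) \<Rightarrow> real \<Rightarrow> real \<Rightarrow> bool" where
  "eps_support D F z a \<epsilon> s \<longleftrightarrow> z \<in> D \<and> 0 < s \<and>
     (\<forall>u\<in>D. norm (u - z) \<le> s \<longrightarrow> F z + a (u - z) - \<epsilon> * norm (u - z) \<le> F u)"

lemma eps_support_mono:
  assumes "eps_support D F z a \<epsilon> s" "0 < s'" "s' \<le> s"
  shows "eps_support D F z a \<epsilon> s'"
  using assms unfolding eps_support_def by fastforce

text \<open>
  An additive error that is small compared with the radius of validity turns, by Ekeland's
  principle, into an increased slope at a nearby point.
\<close>

lemma eps_support_of_almost_support: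
  fixes F :: "'a::banach \<Rightarrow> real" and a :: "'a \<Rightarrow>\<^sub>L real"
  assumes lsc: "seq_lsc_on D F" and v: "v \<in> D" and b: "0 \<le> b" and \<tau>: "0 < \<tau>" and \<epsilon>: "0 < \<epsilon>"
    and supp: "\<And>u. \<lbrakk>u \<in> D; norm (u - v) \<le> \<tau>\<rbrakk> \<Longrightarrow>
      F v + a (u - v) - b * norm (u - v) - \<epsilon> / 2 * \<tau> \<le> F u"
  obtains z where "norm (z - v) \<le> \<tau> / 2" "F z \<le> F v + a (z - v)"
    "eps_support D F z a (b + \<epsilon>) (\<tau> / 2)"
    "\<And>u. \<lbrakk>u \<in> D; norm (u - v) \<le> \<tau>\<rbrakk> \<Longrightarrow> F z + a (u - z) - (b + \<epsilon>) * norm (u - z) \<le> F u"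
proof -
  define G where "G u = F u + (b * norm (u - v) - a u)" for u
  have "seq_lsc_on (D \<inter> cball v \<tau>) G"
    unfolding G_def
    by (intro seq_lsc_on_add_continuous seq_lsc_on_Int_closed lsc closed_cball continuous_intros)
  moreover have "v \<in> D \<inter> cball v \<tau>" using v \<tau> by simp
  moreover have low: "F v - a v - \<epsilon> / 2 * \<tau> \<le> G u" if "u \<in> D \<inter> cball v \<tau>" for u
    using supp[of u] that by (simp add: G_def dist_norm norm_minus_commute blinfun.diff_right)
  ultimately obtain z where z: "z \<in> D \<inter> cball v \<tau>" "G z + \<epsilon> * dist z v \<le> G v"
    and min: "\<And>u. u \<in> D \<inter> cball v \<tau> \<Longrightarrow> G z \<le> G u + \<epsilon> * dist u z"
    using ekeland[where c = \<epsilon>] \<epsilon> by metis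
  have "\<epsilon> * dist z v \<le> \<epsilon> * (\<tau> / 2)" using low[OF z(1)] z(2) by (simp add: G_def)
  then have zv: "norm (z - v) \<le> \<tau> / 2" using \<epsilon> by (simp add: dist_norm)
  have main: "F z + a (u - z) - (b + \<epsilon>) * norm (u - z) \<le> F u"
    if u: "u \<in> D" "norm (u - v) \<le> \<tau>" for u
  proof -
    have "b * norm (u - v) \<le> b * (norm (u - z) + norm (z - v))"
      using norm_triangle_ineq[of "u - z" "z - v"] b by (intro mult_left_mono) auto
    with min[of u] u show ?thesis
      by (simp add: G_def dist_norm norm_minus_commute blinfun.diff_right algebra_simps)
  qed
  show thesis
  proof (rule that[OF zv _ _ main])
    have "0 \<le> b * norm (z - v)" "0 \<le> \<epsilon> * dist z v" using b \<epsilon> by auto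
    with z(2) show "F z \<le> F v + a (z - v)" by (simp add: G_def blinfun.diff_right)
    have "norm (u - v) \<le> \<tau>" if "norm (u - z) \<le> \<tau> / 2" for u
      using norm_triangle_ineq[of "u - z" "z - v"] that zv by simp
    then show "eps_support D F z a (b + \<epsilon>) (\<tau> / 2)"
      unfolding eps_support_def using z(1) \<tau> main by auto
  qed
qed

lemma blinfun_le:
  fixes a :: "'a::real_normed_vector \<Rightarrow>\<^sub>L real"
  assumes "norm a \<le> K"
  shows "a x \<le> K * norm x"
  using assms
  by (metis abs_le_iff mult_right_mono norm_blinfun norm_ge_zero order_trans real_norm_def)

text \<open>
  The function \<open>W h v\<close> is \<open>F\<close> plus a cone of slope \<open>r'\<close> with vertex \<open>z + h\<close>. For \<open>h = 0\<close> it is minimal at \<open>z\<close>,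
  and since \<open>r < r'\<close>, its near-minimizers for small \<open>h\<close> stay near \<open>z\<close>. If \<open>h\<close> and \<open>v\<close> move by the same
  vector, the cone term does not change, so the estimate for the family in its parameter is one
  for \<open>F\<close>. The last conclusion, on all of \<open>D\<close>, keeps the earlier estimate alive at
  the new point; the limit argument for \<open>exact_support\<close> depends on it.
\<close>

lemma refine_centered_support:
  fixes F :: "'a::banach \<Rightarrow> real"
  assumes asplund: "asplund TYPE('a)" and lsc: "seq_lsc_on D F" and z: "z \<in> D"
    and supp: "\<And>u. u \<in> D \<Longrightarrow> F z - r * norm (u - z) \<le> F u"
    and r: "0 \<le> r" "r < r'" and \<epsilon>: "0 < \<epsilon>" and \<rho>: "0 < \<rho>"
  obtains y a s where "norm (y - z) \<le> \<rho>" "F y \<le> F z + \<rho>" "norm a \<le> r'" "eps_support D F y a \<epsilon> s"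
    "\<And>u. u \<in> D \<Longrightarrow> F y - (3 * r' + \<epsilon>) * norm (u - y) \<le> F u"
proof -
  have r'0: "0 < r'" using r by linarith
  define W where "W h v = F v + r' * norm (z + h - v)" for h v
  define M where "M = (2 * r' + \<epsilon>) / (r' - r) + (2 * r' + \<epsilon>) + 1"
  have Mpos: "0 < (2 * r' + \<epsilon>) / (r' - r)" using r r'0 \<epsilon> by simp
  then have M: "M > 0" using r'0 \<epsilon> by (simp add: M_def)
  define \<rho>' where "\<rho>' = \<rho> / M"
  have \<rho>': "0 < \<rho>'" "\<rho>' * M = \<rho>" using \<rho> M by (auto simp: \<rho>'_def)
  have Wlip: "W y v - W x v \<le> r' * norm (y - x)" if "v \<in> D" for v x y
  proof -
    have "z + y - v = (z + x - v) + (y - x)" by simp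
    then have "norm (z + y - v) \<le> norm (z + x - v) + norm (y - x)" by (metis norm_triangle_ineq)
    then have "r' * norm (z + y - v) \<le> r' * (norm (z + x - v) + norm (y - x))"
      using r'0 by (intro mult_left_mono) auto
    then show ?thesis by (simp add: W_def algebra_simps)
  qed
  have Wlow: "F z \<le> W 0 v" if "v \<in> D" for v
  proof -
    have "r * norm (v - z) \<le> r' * norm (z - v)"
      using r by (simp add: norm_minus_commute mult_right_mono)
    with supp[OF that] show ?thesis by (simp add: W_def)
  qed
  have ne: "D \<noteq> {}" and \<epsilon>2: "0 < \<epsilon> / 2" using z \<epsilon> by auto
  obtain h v a \<tau> where h: "norm h < \<rho>'" "v \<in> D" "0 < \<tau>" "\<tau> < \<rho>'" "norm a \<le> r'"
    and mar: "\<And>w v'. \<lbrakk>norm w \<le> \<tau>; v' \<in> D\<rbrakk> \<Longrightarrow>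
      W h v + blinfun_apply a w - \<epsilon> / 2 * \<tau> \<le> W (h + w) v'"
    by (rule asplund_marginal_almost_support[where A = D and W = W, OF asplund less_imp_le[OF r'0] Wlip ne Wlow \<rho>'(1) \<epsilon>2]) (assumption | rule that | blast)+
  have local: "F v + a (u - v) - 0 * norm (u - v) - \<epsilon> / 2 * \<tau> \<le> F u"
    if "u \<in> D" "norm (u - v) \<le> \<tau>" for u
    using mar[of "u - v" u] that by (simp add: W_def algebra_simps)
  have contact: "F v - r' * norm (u - v) - \<epsilon> / 2 * \<tau> \<le> F u" if "u \<in> D" for u
  proof -
    have "r' * norm (z + h - u) \<le> r' * (norm (z + h - v) + norm (u - v))"
      using norm_triangle_ineq[of "z + h - v" "v - u"] r'0
      by (intro mult_left_mono) (auto simp: norm_minus_commute)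
    with mar[of 0 u] that h(3) show ?thesis by (simp add: W_def algebra_simps)
  qed
  obtain y where y: "norm (y - v) \<le> \<tau> / 2" "F y \<le> F v + a (y - v)"
    and supp_y: "eps_support D F y a (0 + \<epsilon>) (\<tau> / 2)"
    and near: "\<And>u. \<lbrakk>u \<in> D; norm (u - v) \<le> \<tau>\<rbrakk> \<Longrightarrow>
      F y + a (u - y) - (0 + \<epsilon>) * norm (u - y) \<le> F u"
    using eps_support_of_almost_support[OF lsc h(2) order_refl h(3) \<epsilon> local] by blast
  have ay: "a (y - v) \<le> r' * (\<tau> / 2)"
  proof -
    have "a (y - v) \<le> r' * norm (y - v)" by (rule blinfun_le[OF h(5)])
    also have "\<dots> \<le> r' * (\<tau> / 2)" using y(1) r'0 by (intro mult_left_mono) auto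
    finally show ?thesis .
  qed
  have r\<tau>: "r' * \<tau> \<le> r' * \<rho>'" "\<epsilon> * \<tau> \<le> \<epsilon> * \<rho>'" "r' * norm h \<le> r' * \<rho>'"
    using h r'0 \<epsilon> by (auto intro!: mult_left_mono)
  have \<rho>'nn: "0 \<le> r' * \<rho>'" "0 \<le> \<epsilon> * \<rho>'" using r'0 \<epsilon> \<rho>'(1) by auto
  have Wz: "F v + r' * norm (z + h - v) \<le> F z + r' * norm h + \<epsilon> / 2 * \<tau>"
    using mar[of 0 z] z h(3) by (simp add: W_def)
  have "(r' - r) * norm (v - z) \<le> (2 * r' + \<epsilon>) * \<rho>'"
  proof -
    have "r' * norm (v - z) \<le> r' * (norm (z + h - v) + norm h)"
      using norm_triangle_ineq[of "v - z - h" h] r'0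
      by (intro mult_left_mono) (auto simp: norm_minus_commute algebra_simps)
    with Wz supp[OF h(2)] r\<tau> \<rho>'nn show ?thesis by (simp add: algebra_simps)
  qed
  then have vz: "norm (v - z) \<le> (2 * r' + \<epsilon>) / (r' - r) * \<rho>'"
    using r by (simp add: field_simps)
  show thesis
  proof (rule that)
    have "norm (y - z) \<le> norm (y - v) + norm (v - z)"
      using norm_triangle_ineq[of "y - v" "v - z"] by simp
    also have "\<dots> \<le> \<rho>' * 1 + (2 * r' + \<epsilon>) / (r' - r) * \<rho>'" using y(1) h(3,4) vz by linarith
    also have "\<dots> \<le> \<rho>' * M"
      using \<rho>'nn by (simp add: M_def algebra_simps)
    finally show "norm (y - z) \<le> \<rho>" using \<rho>'(2) by simp
    have "0 \<le> r' * norm (z + h - v)" using r'0 by simp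
    then have "F y \<le> F z + r' * norm h + \<epsilon> / 2 * \<tau> + r' * (\<tau> / 2)"
      using Wz y(2) ay by linarith
    also have "\<dots> \<le> F z + (2 * r' + \<epsilon>) * \<rho>'" using r\<tau> \<rho>'nn by (simp add: algebra_simps)
    also have "(2 * r' + \<epsilon>) * \<rho>' \<le> M * \<rho>'"
      using \<rho>'(1) Mpos by (intro mult_right_mono) (auto simp: M_def)
    finally show "F y \<le> F z + \<rho>" using \<rho>'(2) by (simp add: mult.commute)
    show "norm a \<le> r'" by fact
    show "eps_support D F y a \<epsilon> (\<tau> / 2)" using supp_y by simp
    fix u assume u: "u \<in> D"
    show "F y - (3 * r' + \<epsilon>) * norm (u - y) \<le> F u"
    proof (cases "norm (u - v) \<le> \<tau>")
      case True
      have "a (y - u) \<le> r' * norm (u - y)" using blinfun_le[OF h(5), of "y - u"] by (simp add: norm_minus_commute)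
      moreover have "0 \<le> r' * norm (u - y)" using r'0 by simp
      ultimately show ?thesis using near[OF u True] by (simp add: algebra_simps blinfun.diff_right)
    next
      case False
      have t: "norm (u - v) \<le> norm (u - y) + \<tau> / 2"
        using norm_triangle_ineq[of "u - y" "y - v"] y(1) by simp
      have "\<tau> / 2 \<le> norm (u - y)" using t False by linarith
      then have "r' * (\<tau> / 2) \<le> r' * norm (u - y)" "\<epsilon> * (\<tau> / 2) \<le> \<epsilon> * norm (u - y)"
        using r'0 \<epsilon> by (auto intro!: mult_left_mono)
      moreover have "r' * norm (u - v) \<le> r' * (norm (u - y) + \<tau> / 2)"
        using t r'0 by (intro mult_left_mono) auto
      ultimately show ?thesis using contact[OF u] y(2) ay by (simp add: algebra_simps)
    qed
  qed
qed

text \<open>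
  Subtracting \<open>a\<close> and restricting to the ball of radius \<open>s\<close> reduces this to functional zero and a
  support valid on the whole domain.
\<close>

lemma refine_support:
  fixes F :: "'a::banach \<Rightarrow> real"
  assumes asplund: "asplund TYPE('a)" and lsc: "seq_lsc_on D F" and supp: "eps_support D F z a r s"
    and r: "0 \<le> r" "r < r'" and \<epsilon>: "0 < \<epsilon>" and \<rho>: "0 < \<rho>"
  obtains y b t where "norm (y - z) \<le> \<rho>" "F y \<le> F z + \<rho>" "norm (b - a) \<le> r'" "t \<le> s / 2"
    "eps_support D F y b \<epsilon> t"
    "\<And>u. \<lbrakk>u \<in> D; norm (u - z) \<le> s\<rbrakk> \<Longrightarrow>
      F y + a (u - y) - (3 * r' + \<epsilon>) * norm (u - y) \<le> F u"
proof -
  have s: "0 < s" and z: "z \<in> D" using supp by (auto simp: eps_support_def)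
  define E where "E = D \<inter> cball z s"
  define G where "G u = F u + - blinfun_apply a u" for u
  have E: "u \<in> E \<longleftrightarrow> u \<in> D \<and> norm (u - z) \<le> s" for u
    by (auto simp: E_def dist_norm norm_minus_commute)
  have lscG: "seq_lsc_on E G" unfolding G_def E_def
    by (intro seq_lsc_on_add_continuous seq_lsc_on_Int_closed lsc closed_cball continuous_intros)
  define \<rho>' where "\<rho>' = min (s / 2) (\<rho> / (norm a + 1))"
  have pos: "0 < norm a + 1" by (simp add: add_nonneg_pos)
  have "0 < \<rho>'" using s \<rho> pos by (simp add: \<rho>'_def)
  moreover have "\<rho>' \<le> s / 2" "\<rho>' \<le> \<rho> / (norm a + 1)"
    unfolding \<rho>'_def by (rule min.cobounded1, rule min.cobounded2)
  ultimately have \<rho>': "0 < \<rho>'" "\<rho>' \<le> s / 2" "(norm a + 1) * \<rho>' \<le> \<rho>"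
    by (simp_all add: pos_le_divide_eq[OF pos] mult.commute)
  have "\<rho>' \<le> (norm a + 1) * \<rho>'" using \<rho>'(1) by (simp add: algebra_simps)
  then have \<rho>'\<rho>: "\<rho>' \<le> \<rho>" using \<rho>'(3) by linarith
  have "z \<in> E" using z s by (simp add: E)
  have suppG: "G z - r * norm (u - z) \<le> G u" if "u \<in> E" for u
    using supp that by (auto simp: eps_support_def E G_def blinfun.diff_right)
  obtain y b t where y: "norm (y - z) \<le> \<rho>'" "G y \<le> G z + \<rho>'" "norm b \<le> r'" "eps_support E G y b \<epsilon> t"
    and far: "\<And>u. u \<in> E \<Longrightarrow> G y - (3 * r' + \<epsilon>) * norm (u - y) \<le> G u"
    using refine_centered_support[OF asplund lscG \<open>z \<in> E\<close> suppG r \<epsilon> \<rho>'(1)] by blast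
  have yt: "y \<in> E" "0 < t"
    and t: "\<And>u. \<lbrakk>u \<in> E; norm (u - y) \<le> t\<rbrakk> \<Longrightarrow> G y + b (u - y) - \<epsilon> * norm (u - y) \<le> G u"
    using y(4) by (auto simp: eps_support_def)
  show thesis
  proof (rule that)
    show "norm (y - z) \<le> \<rho>" using y(1) \<rho>'\<rho> by linarith
    have "a (y - z) \<le> norm a * \<rho>'"
      using blinfun_le[OF order_refl, of a "y - z"] y(1) by (smt (verit) mult_left_mono norm_ge_zero)
    with y(2) \<rho>'(3) show "F y \<le> F z + \<rho>" by (simp add: G_def blinfun.diff_right algebra_simps)
    show "norm ((a + b) - a) \<le> r'" using y(3) by simp
    show "min t (s / 2) \<le> s / 2" by simp
    have "u \<in> E" if "u \<in> D" "norm (u - y) \<le> s / 2" for u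
      using that y(1) \<rho>'(2) norm_triangle_ineq[of "u - y" "y - z"] by (simp add: E)
    then show "eps_support D F y (a + b) \<epsilon> (min t (s / 2))"
      using t yt s unfolding eps_support_def
      by (force simp: E G_def blinfun.diff_right blinfun.add_left algebra_simps)
    fix u assume "u \<in> D" "norm (u - z) \<le> s"
    with far[of u] show "F y + a (u - y) - (3 * r' + \<epsilon>) * norm (u - y) \<le> F u"
      by (simp add: E G_def blinfun.diff_right algebra_simps)
  qed
qed

text \<open>
  Repeated refinement with \<open>\<epsilon>\<close> halved in each step gives points \<open>z n\<close>, functionals \<open>a n\<close> and radii
  \<open>s n\<close> with limits \<open>y\<close> and \<open>b\<close>. To estimate \<open>F\<close> at a point \<open>u\<close> near \<open>y\<close>, let \<open>Suc k\<close> be the first index for which \<open>u\<close>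
  lies outside the ball of radius \<open>s (Suc k)\<close> about \<open>z (Suc k)\<close>. As \<open>u\<close> is in the previous ball,
  refinement step \<open>k\<close> bounds \<open>F u\<close> in terms of \<open>z (Suc k)\<close> and \<open>a k\<close>; and as \<open>u\<close> is at distance at least
  \<open>s (Suc k)\<close>, replacing \<open>z (Suc k)\<close> by the limit costs only a small multiple of the distance,
  because all later steps together are much shorter than \<open>s (Suc k)\<close>.
\<close>

lemma exact_support:
  fixes F :: "'a::banach \<Rightarrow> real"
  assumes asplund: "asplund TYPE('a)" and lsc: "seq_lsc_on D F" and supp: "eps_support D F z0 a0 \<theta> s0"
    and \<theta>: "0 < \<theta>"
  obtains y b where "norm (y - z0) \<le> s0 / 4" "F y \<le> F z0 + s0 / 4" "norm (b - a0) \<le> 4 * \<theta>" "y \<in> D"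
    "\<And>e. 0 < e \<Longrightarrow> \<exists>t. eps_support D F y b e t"
proof -
  define M where "M = 1 + norm a0 + 15 * \<theta>"
  have M: "\<theta> \<le> M" "0 < M" using \<theta> by (auto simp: M_def add_nonneg_pos)
  define r where "r n = \<theta> / 2 ^ n" for n :: nat
  \<comment> \<open>Step \<open>n\<close> may move by at most \<open>\<kappa> n * s n\<close>. The factor \<open>r n\<close> makes all later moves together
    negligible against \<open>s n\<close>, even multiplied by \<open>M\<close>, which bounds the norms of all functionals.\<close>
  define \<kappa> where "\<kappa> n = r n / (8 * M)" for n
  have r: "0 < r n" "r (Suc n) = r n / 2" "r n \<le> \<theta>" for n
  proof -
    show "0 < r n" "r (Suc n) = r n / 2" using \<theta> by (simp_all add: r_def)
    have "\<theta> * 1 \<le> \<theta> * 2 ^ n" using \<theta> by (intro mult_left_mono) auto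
    then show "r n \<le> \<theta>" by (simp add: r_def divide_le_eq)
  qed
  have r_dec: "r n \<le> r m" if "m \<le> n" for m n
  proof (rule lift_Suc_antimono_le[OF _ that])
    show "r (Suc n) \<le> r n" for n using r(1)[of n] by (simp add: r(2))
  qed
  have \<kappa>: "0 < \<kappa> n" "\<kappa> (Suc n) = \<kappa> n / 2" "\<kappa> n \<le> 1 / 8" "\<kappa> n * (8 * M) = r n" for n
  proof -
    show "0 < \<kappa> n" "\<kappa> (Suc n) = \<kappa> n / 2" "\<kappa> n * (8 * M) = r n"
      using r(1)[of n] M by (simp_all add: \<kappa>_def r(2))
    show "\<kappa> n \<le> 1 / 8" using r(3)[of n] M by (simp add: \<kappa>_def divide_le_eq)
  qed
  define P where "P n st = (case st of (z, a, s) \<Rightarrow>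
      eps_support D F z a (r n) s \<and> (n = 0 \<longrightarrow> st = (z0, a0, s0)))" for n st
  define Q where "Q n st st' = (case st of (z, a, s) \<Rightarrow> case st' of (z', a', s') \<Rightarrow>
      norm (z' - z) \<le> \<kappa> n * s \<and> F z' \<le> F z + \<kappa> n * s \<and> norm (a' - a) \<le> 2 * r n \<and> s' \<le> s / 2 \<and>
      (\<forall>u\<in>D. norm (u - z) \<le> s \<longrightarrow> F z' + blinfun_apply a (u - z') - 7 * r n * norm (u - z') \<le> F u))"
    for n st st'
  have "\<exists>f. \<forall>n. P n (f n) \<and> Q n (f n) (f (Suc n))"
  proof (rule dependent_nat_choice)
    show "\<exists>st. P 0 st" using supp by (intro exI[of _ "(z0, a0, s0)"]) (simp add: P_def r_def)
    fix st n assume "P n st"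
    then obtain z a s where st: "st = (z, a, s)" and sup: "eps_support D F z a (r n) s"
      by (auto simp: P_def)
    have "0 < s" using sup by (simp add: eps_support_def)
    then have pos: "0 < \<kappa> n * s" using \<kappa>(1) by simp
    have rr: "r n < 2 * r n" "0 \<le> r n" using r(1)[of n] by auto
    obtain y b t where y: "norm (y - z) \<le> \<kappa> n * s" "F y \<le> F z + \<kappa> n * s" "norm (b - a) \<le> 2 * r n"
      "t \<le> s / 2" "eps_support D F y b (r (Suc n)) t"
      and far: "\<And>u. \<lbrakk>u \<in> D; norm (u - z) \<le> s\<rbrakk> \<Longrightarrow>
        F y + blinfun_apply a (u - y) - (3 * (2 * r n) + r (Suc n)) * norm (u - y) \<le> F u"
      using refine_support[OF asplund lsc sup rr(2,1) r(1)[of "Suc n"] pos] by blast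
    have "F y + blinfun_apply a (u - y) - 7 * r n * norm (u - y) \<le> F u"
      if "u \<in> D" "norm (u - z) \<le> s" for u
    proof -
      have "(3 * (2 * r n) + r (Suc n)) * norm (u - y) \<le> 7 * r n * norm (u - y)"
        using r[of n] by (intro mult_right_mono) auto
      with far[OF that] show ?thesis by linarith
    qed
    with y show "\<exists>st'. P (Suc n) st' \<and> Q n st st'"
      by (intro exI[of _ "(y, b, t)"]) (simp add: P_def Q_def st)
  qed
  then obtain f where f: "\<And>n. P n (f n)" "\<And>n. Q n (f n) (f (Suc n))" by blast
  define z a s where "z n = fst (f n)" and "a n = fst (snd (f n))" and "s n = snd (snd (f n))" for n
  have f_eq: "f n = (z n, a n, s n)" for n by (simp add: z_def a_def s_def)
  have sup: "eps_support D F (z n) (a n) (r n) (s n)" for n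
    using f(1)[of n] by (simp add: P_def f_eq)
  have init: "z 0 = z0" "a 0 = a0" "s 0 = s0" using f(1)[of 0] by (auto simp: P_def f_eq)
  have zstep: "norm (z (Suc n) - z n) \<le> \<kappa> n * s n" and Fstep: "F (z (Suc n)) \<le> F (z n) + \<kappa> n * s n"
    and astep: "norm (a (Suc n) - a n) \<le> 2 * r n" and sstep: "s (Suc n) \<le> s n / 2"
    and far: "\<And>u. \<lbrakk>u \<in> D; norm (u - z n) \<le> s n\<rbrakk> \<Longrightarrow>
      F (z (Suc n)) + a n (u - z (Suc n)) - 7 * r n * norm (u - z (Suc n)) \<le> F u" for n
    using f(2)[of n] by (auto simp: Q_def f_eq)
  have s: "0 < s n" and zD: "z n \<in> D" for n using sup[of n] by (auto simp: eps_support_def)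
  define e where "e n = 2 * \<kappa> n * s n" for n
  have e: "0 < e n" "e n \<le> s n / 4" "\<kappa> n * s n \<le> e n - e (Suc n)" for n
  proof -
    show "0 < e n" using \<kappa>(1) s by (simp add: e_def)
    have "\<kappa> n * s n \<le> 1 / 8 * s n" using \<kappa>(3) s by (intro mult_right_mono) (auto simp: less_imp_le)
    then show "e n \<le> s n / 4" by (simp add: e_def)
    have "\<kappa> n * s (Suc n) \<le> \<kappa> n * s n"
      using sstep[of n] s[of n] \<kappa>(1)[of n] by (intro mult_left_mono) auto
    then show "\<kappa> n * s n \<le> e n - e (Suc n)" by (simp add: e_def \<kappa>(2))
  qed
  have "s n \<le> s 0 * (1/2) ^ n" for n
  proof (induction n)
    case (Suc n)
    then show ?case using sstep[of n] by simp
  qed simp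
  moreover have "(\<lambda>n. s 0 * (1/2) ^ n) \<longlonglongrightarrow> s 0 * 0"
    by (intro tendsto_intros LIMSEQ_power_zero) auto
  ultimately have s0: "s \<longlonglongrightarrow> 0"
    using s by (intro real_tendsto_sandwich[of "\<lambda>_. 0" s _ "\<lambda>n. s 0 * (1/2) ^ n"])
      (auto simp: less_imp_le)
  have e0: "e \<longlonglongrightarrow> 0"
  proof (rule real_tendsto_sandwich[of "\<lambda>_. 0" e _ "\<lambda>n. s n / 4"])
    show "(\<lambda>n. s n / 4) \<longlonglongrightarrow> 0" using tendsto_divide[OF s0 tendsto_const, of 4] by simp
  qed (use e in \<open>auto simp: less_imp_le\<close>)
  have "dist (z (Suc n)) (z n) \<le> e n - e (Suc n)" for n
    using zstep[of n] e(3)[of n] by (simp add: dist_norm)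
  then obtain y where y: "z \<longlonglongrightarrow> y" "\<And>n. norm (y - z n) \<le> e n"
    using telescoping_limit[OF _ e0] by (metis diff_zero dist_norm)
  have "(\<lambda>n. 4 * r n) \<longlonglongrightarrow> 0"
  proof -
    have "(\<lambda>n. 4 * (\<theta> * (1/2) ^ n)) \<longlonglongrightarrow> 4 * (\<theta> * 0)"
      by (intro tendsto_intros LIMSEQ_power_zero) auto
    then show ?thesis by (simp add: r_def power_divide)
  qed
  moreover have "dist (a (Suc n)) (a n) \<le> 4 * r n - 4 * r (Suc n)" for n
    using astep[of n] by (simp add: dist_norm r(2))
  ultimately obtain b where b: "\<And>n. norm (b - a n) \<le> 4 * r n"
    using telescoping_limit[where z = a and e = "\<lambda>n. 4 * r n" and l = 0] by (metis diff_zero dist_norm)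
  have an: "norm (a n) \<le> norm a0 + 8 * \<theta>" for n
  proof -
    have "norm (a n) \<le> norm (a n - b) + norm (b - a 0) + norm (a 0)"
      using norm_triangle_ineq[of "a n - b" "b - a 0"] norm_triangle_ineq[of "a n - a 0" "a 0"] by simp
    then show ?thesis using b[of n] b[of 0] r(3)[of n] r(3)[of 0] init
      by (simp add: norm_minus_commute)
  qed
  \<comment> \<open>The values \<open>F (z n)\<close> may increase slightly; adding the remaining allowance \<open>e n\<close> makes them
    monotone, hence convergent.\<close>
  define g where "g n = F (z n) + e n" for n
  have "decseq g"
    unfolding g_def using Fstep e(3) by (intro decseq_SucI) (smt (verit))
  have zn0: "norm (z n - z 0) \<le> s 0" for n
  proof -
    have "norm (z n - z 0) \<le> norm (y - z n) + norm (y - z 0)"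
      using norm_triangle_ineq4[of "y - z 0" "y - z n"] by simp
    also have "\<dots> \<le> e n + e 0" using y(2)[of n] y(2)[of 0] by linarith
    also have "e n \<le> e 0"
    proof (rule lift_Suc_antimono_le[of e])
      show "e (Suc n) \<le> e n" for n using e(3)[of n] mult_pos_pos[OF \<kappa>(1)[of n] s[of n]] by linarith
    qed simp
    finally show ?thesis using e(2)[of 0] s[of 0] by simp
  qed
  have "F z0 - (norm a0 + \<theta>) * s0 \<le> g n" for n
  proof -
    have "F z0 + a0 (z n - z0) - \<theta> * norm (z n - z0) \<le> F (z n)"
      using sup[of 0] zD[of n] zn0[of n] init by (auto simp: eps_support_def r_def)
    moreover have "- a0 (z n - z0) \<le> norm a0 * norm (z n - z0)"
      using norm_blinfun[of a0 "z n - z0"] by simp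
    moreover have "(norm a0 + \<theta>) * norm (z n - z0) \<le> (norm a0 + \<theta>) * s0"
      using zn0[of n] init \<theta> by (intro mult_left_mono) auto
    ultimately show ?thesis using e(1)[of n] by (simp add: g_def algebra_simps)
  qed
  then obtain l where l: "g \<longlonglongrightarrow> l" "\<And>n. l \<le> g n"
    using decseq_convergent[OF \<open>decseq g\<close>] by blast
  have "(\<lambda>n. g n - e n) \<longlonglongrightarrow> l - 0" by (intro tendsto_diff l e0)
  then have "(\<lambda>n. F (z n)) \<longlonglongrightarrow> l" by (simp add: g_def)
  from seq_lsc_onD[OF lsc zD y(1) this] have yD: "y \<in> D" and "F y \<le> l" by auto
  then have Fy: "F y \<le> F (z n) + e n" for n using l(2)[of n] by (simp add: g_def)
  have "\<exists>t. eps_support D F y b \<delta> t" if \<delta>: "0 < \<delta>" for \<delta>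
  proof -
    obtain m where m: "13 * r m \<le> \<delta>"
    proof -
      have "\<forall>\<^sub>F n in sequentially. 4 * r n < 4 * \<delta> / 13"
        by (rule order_tendstoD(2)[OF \<open>(\<lambda>n. 4 * r n) \<longlonglongrightarrow> 0\<close>]) (use \<delta> in simp)
      then obtain n where "4 * r n < 4 * \<delta> / 13" by (auto simp: eventually_sequentially)
      then show thesis by (intro that[of n]) auto
    qed
    have "F y + b (u - y) - \<delta> * norm (u - y) \<le> F u" if u: "u \<in> D" "norm (u - y) \<le> s m / 2" for u
    proof (cases "u = y")
      case False
      \<comment> \<open>The first ball that misses \<open>u\<close>; it comes after ball \<open>m\<close>, which contains \<open>u\<close>.\<close>
      define out where "out p \<longleftrightarrow> m \<le> p \<and> s p < norm (u - z p)" for p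
      have "(\<lambda>n. norm (u - z n) - s n) \<longlonglongrightarrow> norm (u - y) - 0" by (intro tendsto_intros y s0)
      then have "\<forall>\<^sub>F n in sequentially. 0 < norm (u - z n) - s n"
        using False by (intro order_tendstoD) auto
      then obtain N where "\<And>n. n \<ge> N \<Longrightarrow> s n < norm (u - z n)" by (auto simp: eventually_sequentially)
      then have "out (max m N)" by (simp add: out_def)
      then obtain p where p: "out p" "\<And>k. k < p \<Longrightarrow> \<not> out k"
        using exists_least_iff[of out] by blast
      have "norm (u - z m) \<le> norm (u - y) + norm (y - z m)"
        using norm_triangle_ineq[of "u - y" "y - z m"] by simp
      also have "\<dots> \<le> s m" using u(2) y(2)[of m] e(2)[of m] s[of m] by linarith
      finally have "p \<noteq> m" using p(1) by (auto simp: out_def)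
      with p(1) have "m < p" by (simp add: out_def)
      then obtain k where k: "p = Suc k" "m \<le> k" by (cases p) auto
      have zk: "norm (u - z k) \<le> s k" using p(2)[of k] k by (simp add: out_def)
      have sp: "s p < norm (u - z p)" using p(1) by (simp add: out_def)
      have uzp: "norm (u - z p) \<le> norm (u - y) + e p"
        using norm_triangle_ineq[of "u - y" "y - z p"] y(2)[of p] by simp
      have sp2: "s p \<le> 2 * norm (u - y)" using sp uzp e(2)[of p] s[of p] by linarith
      have contact: "F (z p) + a k (u - z p) - 7 * r k * norm (u - z p) \<le> F u"
        using far[OF u(1) zk] k by simp
      have eM: "e p * M \<le> 2 * r k * norm (u - y)"
      proof -
        have "e p * M = s p * (r k / 8)" using \<kappa>(4)[of p] by (simp add: e_def k(1) r(2))
        also have "\<dots> \<le> 2 * norm (u - y) * (r k / 8)"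
          using sp2 r(1)[of k] by (intro mult_right_mono) auto
        also have "\<dots> \<le> 2 * r k * norm (u - y)" using r(1)[of k] by simp
        finally show ?thesis .
      qed
      have ak: "- a k (y - z p) \<le> norm (a k) * e p"
        using blinfun_le[OF order_refl, of "a k" "z p - y"] y(2)[of p]
        by (smt (verit) blinfun.minus_right minus_diff_eq mult_left_mono norm_ge_zero norm_minus_commute)
      have rk: "r k * norm (u - z p) \<le> r k * (norm (u - y) + e p)"
        using uzp r(1)[of k] by (intro mult_left_mono) auto
      have "e p * (1 + norm (a k) + 7 * r k) \<le> e p * M"
        using an[of k] r(3)[of k] e(1)[of p] \<theta> by (intro mult_left_mono) (auto simp: M_def)
      then have "F y + a k (u - y) - 9 * r k * norm (u - y) \<le> F u"
        using contact ak rk Fy[of p] eM by (simp add: algebra_simps blinfun.diff_right)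
      moreover have "(b - a k) (u - y) \<le> 4 * r k * norm (u - y)"
        by (rule blinfun_le[OF b])
      moreover have "13 * r k * norm (u - y) \<le> \<delta> * norm (u - y)"
        using r_dec[OF k(2)] m by (intro mult_right_mono) auto
      ultimately show ?thesis by (simp add: blinfun.diff_left)
    qed simp
    then show ?thesis using yD s[of m] by (intro exI[of _ "s m / 2"]) (auto simp: eps_support_def)
  qed
  moreover have "norm (y - z0) \<le> s0 / 4" "F y \<le> F z0 + s0 / 4" "norm (b - a0) \<le> 4 * \<theta>"
    using y(2)[of 0] Fy[of 0] e(2)[of 0] b[of 0] init by (auto simp: r_def)
  ultimately show thesis using yD that by blast
qed

text \<open>
  A preliminary refinement to a tiny slope makes the displacement of the functional
  almost \<open>r\<close> instead of the \<open>4 * r\<close> that the limit process alone would give.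
\<close>

lemma exact_support_near:
  fixes F :: "'a::banach \<Rightarrow> real"
  assumes asplund: "asplund TYPE('a)" and lsc: "seq_lsc_on D F" and supp: "eps_support D F z a r s"
    and r: "0 \<le> r" and \<rho>: "0 < \<rho>"
  obtains y b where "norm (y - z) \<le> \<rho>" "F y \<le> F z + \<rho>" "norm (b - a) \<le> r + \<rho>" "y \<in> D"
    "\<And>e. 0 < e \<Longrightarrow> \<exists>t. eps_support D F y b e t"
proof -
  have "r < r + \<rho> / 2" "0 < \<rho> / 8" "0 < \<rho> / 2" using \<rho> by auto
  then obtain z' a' s' where z': "norm (z' - z) \<le> \<rho> / 2" "F z' \<le> F z + \<rho> / 2" "norm (a' - a) \<le> r + \<rho> / 2"
    "eps_support D F z' a' (\<rho> / 8) s'"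
    using refine_support[OF asplund lsc supp r] by metis
  have "0 < min s' \<rho>" using z'(4) \<rho> by (simp add: eps_support_def)
  then have "eps_support D F z' a' (\<rho> / 8) (min s' \<rho>)"
    by (rule eps_support_mono[OF z'(4)]) simp
  then obtain y b where y: "norm (y - z') \<le> min s' \<rho> / 4" "F y \<le> F z' + min s' \<rho> / 4"
    "norm (b - a') \<le> 4 * (\<rho> / 8)" "y \<in> D" "\<And>e. 0 < e \<Longrightarrow> \<exists>t. eps_support D F y b e t"
    using exact_support[OF asplund lsc _ \<open>0 < \<rho> / 8\<close>] by metis
  show thesis
  proof (rule that[OF _ _ _ y(4,5)])
    show "norm (y - z) \<le> \<rho>"
      using norm_triangle_ineq[of "y - z'" "z' - z"] y(1) z'(1) \<rho> by simp
    have "min s' \<rho> \<le> \<rho>" by simp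
    then show "F y \<le> F z + \<rho>" using y(2) z'(2) \<rho> by linarith
    show "norm (b - a) \<le> r + \<rho>"
      using norm_triangle_ineq[of "b - a'" "a' - a"] y(3) z'(3) by simp
  qed
qed

lemma frechet_subdiffI:
  fixes \<phi> :: "'a::real_normed_vector \<Rightarrow> ereal"
  assumes ninf: "avoids_minus_infinity \<phi>" and x: "x \<in> edom \<phi>" and U: "open U" "x \<in> U"
    and supp: "\<And>e. 0 < e \<Longrightarrow> \<exists>t. eps_support (edom \<phi> \<inter> U) (\<lambda>u. real_of_ereal (\<phi> u)) x a e t"
  shows "a \<in> frechet_subdiff \<phi> x"
proof -
  define q where "q u = (\<phi> u - \<phi> x - ereal (blinfun_apply a (u - x))) / ereal (norm (u - x))" for u
  obtain fx where fx: "\<phi> x = ereal fx"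
    using x ninf by (cases "\<phi> x") (auto simp: edom_def avoids_minus_infinity_def)
  have "0 \<le> Liminf (at x) q"
  proof (subst le_Liminf_iff, intro allI impI)
    fix y :: ereal assume "y < 0"
    then obtain e where e: "0 < e" "y < ereal (- e)"
      by (metis ereal_dense2 ereal_less_eq(5) minus_minus neg_0_less_iff_less zero_ereal_def ereal_less(2) less_ereal.simps(1))
    obtain t where t: "eps_support (edom \<phi> \<inter> U) (\<lambda>u. real_of_ereal (\<phi> u)) x a e t"
      using supp[OF e(1)] by blast
    then have "0 < t" by (simp add: eps_support_def)
    moreover obtain r where "0 < r" "ball x r \<subseteq> U" using U by (meson openE)
    ultimately have "\<forall>\<^sub>F u in at x. u \<in> U \<and> norm (u - x) \<le> t \<and> u \<noteq> x"
      unfolding eventually_at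
      by (intro exI[of _ "min r t"]) (auto simp: dist_norm subset_iff norm_minus_commute)
    then show "\<forall>\<^sub>F u in at x. y < q u"
    proof eventually_elim
      case (elim u)
      then have n: "0 < norm (u - x)" by simp
      have "ereal (- e) \<le> q u"
      proof (cases "\<phi> u")
        case (real fu)
        then have "fx + a (u - x) - e * norm (u - x) \<le> fu"
          using t elim fx by (auto simp: eps_support_def edom_def)
        then have "- e \<le> (fu - fx - a (u - x)) / norm (u - x)"
          using n by (simp add: pos_le_divide_eq)
        then show ?thesis using n by (simp add: q_def real fx)
      next
        case PInf
        then show ?thesis using n by (simp add: q_def fx)
      next
        case MInf
        then show ?thesis using ninf by (simp add: avoids_minus_infinity_def)
      qed
      with e(2) show ?case by (rule less_le_trans)
    qed
  qed
  with x show ?thesis by (simp add: frechet_subdiff_def q_def[abs_def])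
qed


section \<open>Decoupling a penalized sum\<close>

text \<open>
  The parameter \<open>h\<close> displaces the first variable in the penalty only. Compensating \<open>h\<close> by moving
  the first index point leaves the penalty unchanged and gives the estimate for \<open>F1\<close>. Moving the
  second index point in the opposite direction also leaves the coupling term unchanged, but changes
  the two terms with factor \<open>c'\<close>; hence \<open>F2\<close> is supported by the negative functional with the slope
  \<open>2 * c'\<close>, independent of the large coupling factor \<open>\<gamma>\<close>. The gap between \<open>c\<close> and \<open>c'\<close> keeps the near-minimizers
  close to \<open>(z1, z2)\<close>.
\<close>

lemma decoupled_supports:
  fixes F1 F2 :: "'a::banach \<Rightarrow> real"
  assumes asplund: "asplund TYPE('a)" and lsc1: "seq_lsc_on D1 F1" and lsc2: "seq_lsc_on D2 F2"
    and z: "z1 \<in> D1" "z2 \<in> D2"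
    and \<gamma>: "0 \<le> \<gamma>" and c: "0 \<le> c" "c < c'" and \<epsilon>: "0 < \<epsilon>" and \<rho>: "0 < \<rho>"
    and min: "\<And>u1 u2. \<lbrakk>u1 \<in> D1; u2 \<in> D2\<rbrakk> \<Longrightarrow> F1 z1 + F2 z2 \<le>
      F1 u1 + F2 u2 + \<gamma> * norm ((u1 - z1) - (u2 - z2)) + c * norm (u1 - z1) + c * norm (u2 - z2)"
  obtains y1 y2 a s where "norm (y1 - z1) \<le> \<rho>" "norm (y2 - z2) \<le> \<rho>"
    "F1 y1 + F2 y2 \<le> F1 z1 + F2 z2 + \<rho>"
    "eps_support D1 F1 y1 a \<epsilon> s" "eps_support D2 F2 y2 (- a) (2 * c' + \<epsilon>) s"
proof -
  have c'0: "0 < c'" using c by linarith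
  define K where "K = \<gamma> + c'"
  have K: "0 < K" using \<gamma> c'0 by (simp add: K_def)
  define A where "A = D1 \<times> D2"
  define W where "W h v = (case v of (v1, v2) \<Rightarrow> F1 v1 + F2 v2 + \<gamma> * norm (h + (z1 - v1) - (z2 - v2))
      + c' * norm (h + (z1 - v1)) + c' * norm (z2 - v2))" for h v
  define M where "M = (2 * K + \<epsilon>) / (c' - c) + (2 * K + \<epsilon>) + 1"
  have Mpos: "0 < (2 * K + \<epsilon>) / (c' - c)" using c K \<epsilon> by simp
  then have M: "M > 0" using K \<epsilon> by (simp add: M_def)
  define \<rho>' where "\<rho>' = \<rho> / M"
  have \<rho>': "0 < \<rho>'" "\<rho>' * M = \<rho>" using \<rho> M by (auto simp: \<rho>'_def)
  have Wlip: "W y v - W x v \<le> K * norm (y - x)" if "v \<in> A" for v x y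
  proof -
    obtain v1 v2 where v: "v = (v1, v2)" by fastforce
    have shift: "norm (y + q) \<le> norm (x + q) + norm (y - x)" for q
      using norm_triangle_ineq[of "x + q" "y - x"] by (simp add: algebra_simps)
    have "\<gamma> * norm (y + (z1 - v1) - (z2 - v2)) \<le> \<gamma> * (norm (x + (z1 - v1) - (z2 - v2)) + norm (y - x))"
      using shift[of "(z1 - v1) - (z2 - v2)"] \<gamma> by (intro mult_left_mono) (simp_all add: add_diff_eq)
    moreover have "c' * norm (y + (z1 - v1)) \<le> c' * (norm (x + (z1 - v1)) + norm (y - x))"
      using shift c'0 by (intro mult_left_mono) auto
    ultimately show ?thesis by (simp add: W_def v K_def algebra_simps)
  qed
  have Wlow: "F1 z1 + F2 z2 \<le> W 0 v" if vA: "v \<in> A" for v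
  proof -
    obtain v1 v2 where v: "v = (v1, v2)" "v1 \<in> D1" "v2 \<in> D2" using vA by (auto simp: A_def)
    have "norm ((z1 - v1) - (z2 - v2)) = norm ((v1 - z1) - (v2 - z2))"
      using norm_minus_cancel[of "(z1 - v1) - (z2 - v2)"] by (simp add: algebra_simps)
    moreover have "c * norm (v1 - z1) \<le> c' * norm (z1 - v1)" "c * norm (v2 - z2) \<le> c' * norm (z2 - v2)"
      using c by (auto simp: norm_minus_commute intro!: mult_right_mono)
    ultimately show ?thesis using min[OF v(2,3)] by (simp add: W_def v(1))
  qed
  have ne: "A \<noteq> {}" and \<epsilon>2: "0 < \<epsilon> / 2" using z \<epsilon> by (auto simp: A_def)
  obtain h v a \<tau> where h: "norm h < \<rho>'" "v \<in> A" "0 < \<tau>" "\<tau> < \<rho>'" "norm a \<le> K"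
    and mar0: "\<And>w v'. \<lbrakk>norm w \<le> \<tau>; v' \<in> A\<rbrakk> \<Longrightarrow>
      W h v + blinfun_apply a w - \<epsilon> / 2 * \<tau> \<le> W (h + w) v'"
    by (rule asplund_marginal_almost_support[where A = A and W = W, OF asplund less_imp_le[OF K] Wlip ne Wlow \<rho>'(1) \<epsilon>2]) (assumption | rule that | blast)+
  obtain v1 v2 where v: "v = (v1, v2)" "v1 \<in> D1" "v2 \<in> D2" using h(2) by (auto simp: A_def)
  define p q where "p = h + (z1 - v1)" and "q = z2 - v2"
  have mar: "F1 v1 + F2 v2 + \<gamma> * norm (p - q) + c' * norm p + c' * norm q + blinfun_apply a w - \<epsilon> / 2 * \<tau>
      \<le> F1 u1 + F2 u2 + \<gamma> * norm (h + w + (z1 - u1) - (z2 - u2)) + c' * norm (h + w + (z1 - u1))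
        + c' * norm (z2 - u2)"
    if "norm w \<le> \<tau>" "u1 \<in> D1" "u2 \<in> D2" for w u1 u2
    using mar0[of w "(u1, u2)"] that by (simp add: A_def W_def v(1) p_def q_def)
  have local1: "F1 v1 + a (u - v1) - 0 * norm (u - v1) - \<epsilon> / 2 * \<tau> \<le> F1 u"
    if "u \<in> D1" "norm (u - v1) \<le> \<tau>" for u
  proof -
    have "h + (u - v1) + (z1 - u) = p" by (simp add: p_def)
    with mar[OF that(2,1) v(3)] show ?thesis by (simp add: q_def)
  qed
  have local2: "F2 v2 + (- a) (u - v2) - 2 * c' * norm (u - v2) - \<epsilon> / 2 * \<tau> \<le> F2 u"
    if u: "u \<in> D2" "norm (u - v2) \<le> \<tau>" for u
  proof -
    have w: "norm (v2 - u) \<le> \<tau>" using u(2) by (simp add: norm_minus_commute)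
    have eq: "h + (v2 - u) + (z1 - v1) = p + (v2 - u)" "z2 - u = q + (v2 - u)"
      "h + (v2 - u) + (z1 - v1) - (z2 - u) = p - q"
      by (simp_all add: p_def q_def)
    have "c' * norm (p + (v2 - u)) \<le> c' * (norm p + norm (u - v2))"
      "c' * norm (q + (v2 - u)) \<le> c' * (norm q + norm (u - v2))"
      using norm_triangle_ineq[of p "v2 - u"] norm_triangle_ineq[of q "v2 - u"] c'0
      by (auto simp: norm_minus_commute)
    with mar[OF w v(2) u(1)] show ?thesis
      unfolding eq(3) unfolding eq(1,2)
      by (simp add: algebra_simps blinfun.diff_right blinfun.minus_left)
  qed
  have "0 \<le> (0::real)" "0 \<le> 2 * c'" using c'0 by auto
  obtain y1 where y1: "norm (y1 - v1) \<le> \<tau> / 2" "F1 y1 \<le> F1 v1 + a (y1 - v1)"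
    "eps_support D1 F1 y1 a (0 + \<epsilon>) (\<tau> / 2)"
    using eps_support_of_almost_support[OF lsc1 v(2) \<open>0 \<le> 0\<close> h(3) \<epsilon> local1] by blast
  obtain y2 where y2: "norm (y2 - v2) \<le> \<tau> / 2" "F2 y2 \<le> F2 v2 + (- a) (y2 - v2)"
    "eps_support D2 F2 y2 (- a) (2 * c' + \<epsilon>) (\<tau> / 2)"
    using eps_support_of_almost_support[OF lsc2 v(3) \<open>0 \<le> 2 * c'\<close> h(3) \<epsilon> local2] by blast
  have aK: "blinfun_apply a' x \<le> K * (\<tau> / 2)" if "norm x \<le> \<tau> / 2" "norm a' \<le> K"
    for a' :: "'a \<Rightarrow>\<^sub>L real" and x
    using blinfun_le[OF that(2), of x] mult_left_mono[OF that(1), of K] K by linarith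
  have ay: "a (y1 - v1) \<le> K * (\<tau> / 2)" "(- a) (y2 - v2) \<le> K * (\<tau> / 2)"
    using aK y1(1) y2(1) h(5) by auto
  have K\<tau>: "K * \<tau> \<le> K * \<rho>'" "\<epsilon> * \<tau> \<le> \<epsilon> * \<rho>'" "K * norm h \<le> K * \<rho>'"
    using h K \<epsilon> by (auto intro!: mult_left_mono)
  have \<rho>'nn: "0 \<le> K * \<rho>'" "0 \<le> \<epsilon> * \<rho>'" using K \<epsilon> \<rho>'(1) by auto
  have Wz: "F1 v1 + F2 v2 + \<gamma> * norm (p - q) + c' * norm p + c' * norm q
      \<le> F1 z1 + F2 z2 + K * norm h + \<epsilon> / 2 * \<tau>"
    using mar[of 0 z1 z2] z h(3) by (simp add: K_def algebra_simps)
  have nn: "0 \<le> \<gamma> * norm (p - q)" "0 \<le> c' * norm p" "0 \<le> c' * norm q" using \<gamma> c'0 by auto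
  have "(c' - c) * (norm (v1 - z1) + norm (v2 - z2)) \<le> (2 * K + \<epsilon>) * \<rho>'"
  proof -
    have "v1 - z1 = h - p" "v2 - z2 = - q" "(v1 - z1) - (v2 - z2) = h - (p - q)"
      by (auto simp: p_def q_def)
    then have "norm (v1 - z1) \<le> norm h + norm p" "norm (v2 - z2) = norm q"
      "norm ((v1 - z1) - (v2 - z2)) \<le> norm h + norm (p - q)"
      by (metis norm_triangle_ineq4, metis norm_minus_cancel, metis norm_triangle_ineq4)
    then have "c' * norm (v1 - z1) \<le> c' * (norm h + norm p)" "c' * norm (v2 - z2) = c' * norm q"
      "\<gamma> * norm ((v1 - z1) - (v2 - z2)) \<le> \<gamma> * (norm h + norm (p - q))"
      using c'0 \<gamma> by (auto intro!: mult_left_mono)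
    then have "c' * norm (v1 - z1) + c' * norm (v2 - z2) - c * norm (v1 - z1) - c * norm (v2 - z2)
        \<le> 2 * (K * norm h) + \<epsilon> / 2 * \<tau>"
      using Wz min[OF v(2,3)] unfolding K_def distrib_left distrib_right by linarith
    then have "(c' - c) * (norm (v1 - z1) + norm (v2 - z2)) \<le> 2 * (K * norm h) + \<epsilon> / 2 * \<tau>"
      by (simp add: algebra_simps)
    then show ?thesis using K\<tau> \<rho>'nn by (simp add: algebra_simps)
  qed
  then have "norm (v1 - z1) + norm (v2 - z2) \<le> (2 * K + \<epsilon>) / (c' - c) * \<rho>'"
    using c by (simp add: field_simps)
  then have vz: "norm (v1 - z1) \<le> (2 * K + \<epsilon>) / (c' - c) * \<rho>'" "norm (v2 - z2) \<le> (2 * K + \<epsilon>) / (c' - c) * \<rho>'"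
    using norm_ge_zero[of "v1 - z1"] norm_ge_zero[of "v2 - z2"] by linarith+
  have near: "norm (y - zz) \<le> \<rho>"
    if "norm (y - vv) \<le> \<tau> / 2" "norm (vv - zz) \<le> (2 * K + \<epsilon>) / (c' - c) * \<rho>'" for y vv zz :: 'a
  proof -
    have "norm (y - zz) \<le> norm (y - vv) + norm (vv - zz)"
      using norm_triangle_ineq[of "y - vv" "vv - zz"] by simp
    also have "\<dots> \<le> \<rho>' * 1 + (2 * K + \<epsilon>) / (c' - c) * \<rho>'" using that h(3,4) by linarith
    also have "\<dots> \<le> \<rho>' * M" using \<rho>'nn by (simp add: M_def algebra_simps)
    finally show ?thesis using \<rho>'(2) by simp
  qed
  show thesis
  proof (rule that)
    show "norm (y1 - z1) \<le> \<rho>" "norm (y2 - z2) \<le> \<rho>" using near y1(1) y2(1) vz by blast+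
    have "F1 y1 + F2 y2 \<le> F1 z1 + F2 z2 + K * norm h + \<epsilon> / 2 * \<tau> + K * \<tau>"
      using Wz nn y1(2) y2(2) ay by linarith
    also have "\<dots> \<le> F1 z1 + F2 z2 + (2 * K + \<epsilon>) * \<rho>'" using K\<tau> \<rho>'nn by (simp add: algebra_simps)
    also have "(2 * K + \<epsilon>) * \<rho>' \<le> M * \<rho>'"
      using \<rho>'(1) Mpos by (intro mult_right_mono) (auto simp: M_def)
    finally show "F1 y1 + F2 y2 \<le> F1 z1 + F2 z2 + \<rho>" using \<rho>'(2) by (simp add: mult.commute)
    show "eps_support D1 F1 y1 a \<epsilon> (\<tau> / 2)" using y1(3) by simp
    show "eps_support D2 F2 y2 (- a) (2 * c' + \<epsilon>) (\<tau> / 2)" by (fact y2(3))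
  qed
qed


section \<open>Quasiuniform minima\<close>

text \<open>
  Closed balls of smaller radius are essentially interior, and the limit that defines
  \<^const>\<open>Lambda_circ\<close> is eventually above any smaller level. The strict inequality leaves room for
  a level \<open>q\<close> that works for all radii at once.
\<close>

lemma quasiuniform_min_uniform_gap:
  fixes \<phi>1 \<phi>2 :: "'a::real_normed_vector \<Rightarrow> ereal"
  assumes qmin: "quasiuniform_min \<epsilon> \<delta> \<phi>1 \<phi>2 xb" and p: "\<phi>1 xb + \<phi>2 xb = ereal p" and \<epsilon>: "0 < \<epsilon>"
  obtains q where "p - \<epsilon> < q" "q < p"
    "\<And>R. R < \<delta> \<Longrightarrow> \<exists>\<eta>>0. \<forall>u1\<in>cball xb R. \<forall>u2\<in>cball xb R. norm (u1 - u2) < \<eta> \<longrightarrow> ereal q \<le> \<phi>1 u1 + \<phi>2 u2"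
proof -
  define L where "L = Lambda_dagger (ball xb \<delta>) \<phi>1 \<phi>2"
  have "ereal p < L + ereal \<epsilon>" using qmin p by (simp add: quasiuniform_min_def L_def)
  then have "ereal (p - \<epsilon>) < L" by (cases L) auto
  moreover have "ereal (p - \<epsilon>) < ereal p" using \<epsilon> by simp
  ultimately have "ereal (p - \<epsilon>) < min L (ereal p)" by simp
  then obtain q where q: "ereal (p - \<epsilon>) < ereal q" "ereal q < min L (ereal p)"
    using ereal_dense2 by blast
  have "\<exists>\<eta>>0. \<forall>u1\<in>cball xb R. \<forall>u2\<in>cball xb R. norm (u1 - u2) < \<eta> \<longrightarrow> ereal q \<le> \<phi>1 u1 + \<phi>2 u2"
    if R: "R < \<delta>" for R
  proof -
    define g :: "real \<Rightarrow> ereal" where "g = (\<lambda>\<eta>. INF (x1, x2) \<in>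
      {(x1, x2). x1 \<in> cball xb R \<and> x2 \<in> cball xb R \<and> norm (x1 - x2) < \<eta>}. \<phi>1 x1 + \<phi>2 x2)"
    have "(\<Union>x\<in>cball xb R. ball x (\<delta> - R)) \<subseteq> ball xb \<delta>"
    proof safe
      fix x y assume "x \<in> cball xb R" "y \<in> ball x (\<delta> - R)"
      then show "y \<in> ball xb \<delta>" using dist_triangle[of xb y x] by simp
    qed
    then have "cball xb R \<in> EI (ball xb \<delta>)"
      unfolding EI_def using R by (intro CollectI exI[of _ "\<delta> - R"]) simp
    then have "L \<le> Lambda_circ (cball xb R) \<phi>1 \<phi>2"
      unfolding L_def Lambda_dagger_def by (rule INF_lower)
    moreover have "ereal q < L" using q(2) by simp
    ultimately have "ereal q < Lambda_circ (cball xb R) \<phi>1 \<phi>2" by (simp only: less_le_trans)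
    then have "\<forall>\<^sub>F \<eta> in at_right 0. ereal q < g \<eta>"
      unfolding g_def by (rule order_tendstoD(1)[OF Lambda_circ_tendsto])
    then obtain b where b: "0 < b" "\<And>\<eta>. 0 < \<eta> \<Longrightarrow> \<eta> < b \<Longrightarrow> ereal q < g \<eta>"
      unfolding eventually_at_right_field by auto
    have gb: "ereal q < g (b / 2)" using b by auto
    have "ereal q \<le> \<phi>1 u1 + \<phi>2 u2"
      if "u1 \<in> cball xb R" "u2 \<in> cball xb R" "norm (u1 - u2) < b / 2" for u1 u2
    proof -
      have "g (b / 2) \<le> (case (u1, u2) of (x1, x2) \<Rightarrow> \<phi>1 x1 + \<phi>2 x2)"
        unfolding g_def by (rule INF_lower) (use that in auto)
      with gb show ?thesis by simp
    qed
    then show ?thesis using b(1) by (intro exI[of _ "b / 2"]) simp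
  qed
  with q show thesis by (intro that[of q]) auto
qed

text \<open>
  With a large factor \<open>\<gamma>\<close>, the sum penalized by \<open>\<gamma> * norm (u1 - u2)\<close> is at least \<open>q\<close> on
  the product of two closed balls: for close arguments by the uniform gap, for others by the
  penalty and the lower bounds. The diagonal point at \<open>xb\<close> is therefore minimal up to \<open>p - q < \<epsilon>\<close>, and
  Ekeland's principle yields \<open>(z1, z2)\<close> within the distance \<open>(p - q) / c\<close>, which is less than \<open>\<delta>\<close> for
  a slope \<open>c\<close> still below \<open>\<epsilon> / \<delta>\<close>. The Euclidean product distance is at most the sum of the two
  distances; this sum accounts for the factor 2 in the final estimate.
\<close>

lemma penalized_ekeland_pair:
  fixes \<phi>1 \<phi>2 :: "'a::banach \<Rightarrow> ereal"
  defines "f1 \<equiv> \<lambda>x. real_of_ereal (\<phi>1 x)" and "f2 \<equiv> \<lambda>x. real_of_ereal (\<phi>2 x)"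
  assumes ninf: "avoids_minus_infinity \<phi>1" "avoids_minus_infinity \<phi>2"
    and lsc: "lsc \<phi>1" "lsc \<phi>2" and xb: "xb \<in> edom \<phi>1" "xb \<in> edom \<phi>2"
    and \<epsilon>: "0 < \<epsilon>" and \<delta>: "0 < \<delta>" and qmin: "quasiuniform_min \<epsilon> \<delta> \<phi>1 \<phi>2 xb"
    and bdd: "bounded_below_on (ball xb \<delta>) \<phi>1" "bounded_below_on (ball xb \<delta>) \<phi>2" and \<eta>: "0 < \<eta>"
  obtains z1 z2 R c \<gamma> where "R < \<delta>" "0 < c" "c < \<epsilon> / \<delta>" "0 \<le> \<gamma>"
    "z1 \<in> edom \<phi>1" "z2 \<in> edom \<phi>2" "norm (z1 - xb) < R" "norm (z2 - xb) < R"
    "norm (z1 - z2) < \<eta>" "f1 z1 + f2 z2 \<le> f1 xb + f2 xb"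
    "\<And>u1 u2. \<lbrakk>u1 \<in> edom \<phi>1 \<inter> cball xb R; u2 \<in> edom \<phi>2 \<inter> cball xb R\<rbrakk> \<Longrightarrow> f1 z1 + f2 z2 \<le>
      f1 u1 + f2 u2 + \<gamma> * norm ((u1 - z1) - (u2 - z2)) + c * norm (u1 - z1) + c * norm (u2 - z2)"
proof -
  have f1: "\<phi>1 x = ereal (f1 x)" if "x \<in> edom \<phi>1" for x
    using that ninf(1) by (cases "\<phi>1 x") (auto simp: edom_def avoids_minus_infinity_def f1_def)
  have f2: "\<phi>2 x = ereal (f2 x)" if "x \<in> edom \<phi>2" for x
    using that ninf(2) by (cases "\<phi>2 x") (auto simp: edom_def avoids_minus_infinity_def f2_def)
  define p where "p = f1 xb + f2 xb"
  have "\<phi>1 xb + \<phi>2 xb = ereal p" using f1 f2 xb by (simp add: p_def)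
  from quasiuniform_min_uniform_gap[OF qmin this \<epsilon>] obtain q where q: "p - \<epsilon> < q" "q < p"
    and gap: "\<And>R. R < \<delta> \<Longrightarrow> \<exists>\<eta>>0. \<forall>u1\<in>cball xb R. \<forall>u2\<in>cball xb R.
        norm (u1 - u2) < \<eta> \<longrightarrow> ereal q \<le> \<phi>1 u1 + \<phi>2 u2" by blast
  \<comment> \<open>Here \<open>\<mu>\<close> bounds the displacement in Ekeland's principle; any value strictly between
    \<open>\<delta> * (p - q) / \<epsilon>\<close> and \<open>\<delta>\<close> makes the slope \<open>c = (p - q) / \<mu>\<close> smaller than \<open>\<epsilon> / \<delta>\<close>.\<close>
  define \<mu> where "\<mu> = (\<delta> * (p - q) / \<epsilon> + \<delta>) / 2"
  have "\<delta> * (p - q) < \<delta> * \<epsilon>" using q \<delta> by (intro mult_strict_left_mono) auto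
  then have \<mu>0: "\<delta> * (p - q) / \<epsilon> < \<delta>" using \<epsilon> by (simp add: divide_less_eq)
  have nn: "0 < \<delta> * (p - q) / \<epsilon>" using q \<delta> \<epsilon> by simp
  have midpoint: "0 < (w + \<delta>) / 2 \<and> (w + \<delta>) / 2 < \<delta> \<and> w < (w + \<delta>) / 2" if "0 < w" "w < \<delta>" for w
    using that by simp
  have \<mu>: "0 < \<mu>" "\<mu> < \<delta>" "\<delta> * (p - q) / \<epsilon> < \<mu>" 
    using midpoint[OF nn \<mu>0] unfolding \<mu>_def by blast+
  define R where "R = (\<mu> + \<delta>) / 2"
  have R: "\<mu> < R" "R < \<delta>" "0 < R" using \<mu> by (auto simp: R_def)
  define c where "c = (p - q) / \<mu>"
  have c: "0 < c" "c * \<mu> = p - q" using q \<mu> by (auto simp: c_def)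
  have c_less: "c < \<epsilon> / \<delta>" using \<mu>(1,3) \<delta> \<epsilon> by (simp add: c_def field_simps)
  obtain \<eta>0 where \<eta>0: "0 < \<eta>0" and gap0: "\<And>u1 u2. \<lbrakk>u1 \<in> cball xb R; u2 \<in> cball xb R; norm (u1 - u2) < \<eta>0\<rbrakk>
      \<Longrightarrow> ereal q \<le> \<phi>1 u1 + \<phi>2 u2" using gap[OF R(2)] by blast
  have sub: "cball xb R \<subseteq> ball xb \<delta>" using R by auto
  obtain b1 where b1: "\<And>x. x \<in> ball xb \<delta> \<Longrightarrow> ereal b1 \<le> \<phi>1 x"
    using bdd(1) unfolding bounded_below_on_def by blast
  obtain b2 where b2: "\<And>x. x \<in> ball xb \<delta> \<Longrightarrow> ereal b2 \<le> \<phi>2 x"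
    using bdd(2) unfolding bounded_below_on_def by blast
  define D1 D2 where "D1 = edom \<phi>1 \<inter> cball xb R" and "D2 = edom \<phi>2 \<inter> cball xb R"
  have low1: "b1 \<le> f1 x" if "x \<in> D1" for x
    using b1[of x] f1[of x] that sub by (auto simp: D1_def)
  have low2: "b2 \<le> f2 x" if "x \<in> D2" for x
    using b2[of x] f2[of x] that sub by (auto simp: D2_def)
  \<comment> \<open>The first summand lifts pairs at distance at least \<open>\<eta>0\<close> above the level \<open>q\<close>; the second
    forces minimizing pairs to be closer than \<open>\<eta>\<close>.\<close>
  define \<gamma> where "\<gamma> = \<bar>q - b1 - b2\<bar> / \<eta>0 + (\<bar>p - b1 - b2\<bar> + 1) / \<eta>"
  have t: "0 \<le> \<bar>q - b1 - b2\<bar> / \<eta>0" "0 < (\<bar>p - b1 - b2\<bar> + 1) / \<eta>"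
    using \<eta>0 \<eta> by (auto intro!: divide_pos_pos)
  have \<gamma>: "0 < \<gamma>" using t by (simp add: \<gamma>_def)
  have "\<bar>q - b1 - b2\<bar> / \<eta>0 \<le> \<gamma>" "(\<bar>p - b1 - b2\<bar> + 1) / \<eta> \<le> \<gamma>" using t by (auto simp: \<gamma>_def)
  then have \<gamma>1: "\<bar>q - b1 - b2\<bar> \<le> \<gamma> * \<eta>0" and \<gamma>2: "\<bar>p - b1 - b2\<bar> + 1 \<le> \<gamma> * \<eta>"
    using \<eta>0 \<eta> by (auto simp: pos_divide_le_eq)
  define F where "F w = f1 (fst w) + f2 (snd w) + \<gamma> * norm (fst w - snd w)" for w
  have lscF: "seq_lsc_on (D1 \<times> D2) F"
    unfolding F_def
  proof (rule seq_lsc_on_add_continuous)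
    have "seq_lsc_on D1 f1" "seq_lsc_on D2 f2"
      unfolding D1_def D2_def f1_def f2_def
      by (intro seq_lsc_on_Int_closed closed_cball seq_lsc_on_lsc lsc ninf)+
    then show "seq_lsc_on (D1 \<times> D2) (\<lambda>w. f1 (fst w) + f2 (snd w))"
      using low1 low2 by (rule seq_lsc_on_sum)
  qed (intro continuous_intros)
  have Fq: "q \<le> F w" if w: "w \<in> D1 \<times> D2" for w
  proof -
    obtain u1 u2 where u: "w = (u1, u2)" "u1 \<in> D1" "u2 \<in> D2" using w by blast
    show ?thesis
    proof (cases "norm (u1 - u2) < \<eta>0")
      case True
      then have "ereal q \<le> \<phi>1 u1 + \<phi>2 u2" using u gap0 by (auto simp: D1_def D2_def)
      then have "q \<le> f1 u1 + f2 u2" using f1[of u1] f2[of u2] u by (simp add: D1_def D2_def)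
      moreover have "0 \<le> \<gamma> * norm (u1 - u2)" using \<gamma> by simp
      ultimately show ?thesis by (simp add: F_def u)
    next
      case False
      then have "\<gamma> * \<eta>0 \<le> \<gamma> * norm (u1 - u2)" using \<gamma> by (intro mult_left_mono) auto
      then show ?thesis using low1[OF u(2)] low2[OF u(3)] \<gamma>1 by (simp add: F_def u)
    qed
  qed
  have "(xb, xb) \<in> D1 \<times> D2" using xb R by (simp add: D1_def D2_def)
  then obtain z where z: "z \<in> D1 \<times> D2" "F z + c * dist z (xb, xb) \<le> F (xb, xb)"
    and min: "\<And>u. u \<in> D1 \<times> D2 \<Longrightarrow> F z \<le> F u + c * dist u z"
    using ekeland[OF lscF _ Fq c(1)] by blast
  obtain z1 z2 where z12: "z = (z1, z2)" "z1 \<in> D1" "z2 \<in> D2" using z(1) by blast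
  have Fxb: "F (xb, xb) = p" by (simp add: F_def p_def)
  have "c * dist z (xb, xb) \<le> c * \<mu>" using z(2) Fq[OF z(1)] Fxb c(2) by linarith
  then have dz: "dist z (xb, xb) \<le> \<mu>" using c(1) by simp
  have pen: "0 \<le> c * dist z (xb, xb)" "0 \<le> \<gamma> * norm (z1 - z2)" using c \<gamma> by auto
  show thesis
  proof (rule that[of R c \<gamma> z1 z2])
    show "R < \<delta>" "0 < c" "c < \<epsilon> / \<delta>" "0 \<le> \<gamma>" using R c c_less \<gamma> by auto
    show "z1 \<in> edom \<phi>1" "z2 \<in> edom \<phi>2" using z12 by (auto simp: D1_def D2_def)
    show "norm (z1 - xb) < R" "norm (z2 - xb) < R"
      using dist_fst_le[of z "(xb, xb)"] dist_snd_le[of z "(xb, xb)"] dz R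
      by (auto simp: z12 dist_norm)
    have le: "f1 z1 + f2 z2 + \<gamma> * norm (z1 - z2) \<le> p"
      using z(2) pen Fxb by (simp add: F_def z12)
    then have "\<gamma> * norm (z1 - z2) < \<gamma> * \<eta>" using low1[OF z12(2)] low2[OF z12(3)] \<gamma>2 by linarith
    then show "norm (z1 - z2) < \<eta>" using \<gamma> by simp
    show "f1 z1 + f2 z2 \<le> f1 xb + f2 xb" using le pen by (simp add: p_def)
    fix u1 u2 assume u: "u1 \<in> edom \<phi>1 \<inter> cball xb R" "u2 \<in> edom \<phi>2 \<inter> cball xb R"
    then have m: "F z \<le> F (u1, u2) + c * dist (u1, u2) z" by (intro min) (auto simp: D1_def D2_def)
    have "norm (u1 - u2) \<le> norm ((u1 - z1) - (u2 - z2)) + norm (z1 - z2)"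
      using norm_triangle_ineq[of "(u1 - z1) - (u2 - z2)" "z1 - z2"] by simp
    then have "\<gamma> * norm (u1 - u2) \<le> \<gamma> * (norm ((u1 - z1) - (u2 - z2)) + norm (z1 - z2))"
      using \<gamma> by (intro mult_left_mono) auto
    moreover have "dist (u1, u2) z \<le> norm (u1 - z1) + norm (u2 - z2)"
      by (simp add: z12 dist_norm norm_Pair_le)
    then have "c * dist (u1, u2) z \<le> c * (norm (u1 - z1) + norm (u2 - z2))"
      using c by (intro mult_left_mono) auto
    ultimately show "f1 z1 + f2 z2 \<le>
        f1 u1 + f2 u2 + \<gamma> * norm ((u1 - z1) - (u2 - z2)) + c * norm (u1 - z1) + c * norm (u2 - z2)"
      using m by (simp add: F_def z12 distrib_left)
  qed
qed

lemma edistance_set_plus_less: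
  assumes "a \<in> A" "b \<in> B" "norm (a + b) < r"
  shows "edistance 0 (A + B) < ereal r"
proof -
  have "edistance 0 (A + B) \<le> ereal (dist 0 (a + b))"
    unfolding edistance_def using assms by (intro INF_lower set_plus_intro)
  also have "\<dots> < ereal r" using assms(3) by simp
  finally show ?thesis .
qed

theorem theorem6p7:
  fixes \<phi>1 \<phi>2 :: "'a::banach \<Rightarrow> ereal" and xb :: 'a and \<epsilon> \<delta> :: real
  assumes "avoids_minus_infinity \<phi>1" and "avoids_minus_infinity \<phi>2"
    and "lsc \<phi>1" and "lsc \<phi>2"
    and "xb \<in> edom \<phi>1 \<inter> edom \<phi>2"
    and "\<epsilon> > 0" and "\<delta> > 0"
    and "quasiuniform_min \<epsilon> \<delta> \<phi>1 \<phi>2 xb"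
    and "bounded_below_on (ball xb \<delta>) \<phi>1" and "bounded_below_on (ball xb \<delta>) \<phi>2"
  shows "(\<forall>\<eta>::real. \<eta> > 0 \<longrightarrow>
            (\<exists>x1\<in>ball xb \<delta>. \<exists>x2\<in>ball xb \<delta>.
               norm (x1 - x2) < \<eta> \<and>
               \<phi>1 x1 + \<phi>2 x2 \<le> \<phi>1 xb + \<phi>2 xb \<and>
               edistance 0 (clarke_subdiff \<phi>1 x1 + clarke_subdiff \<phi>2 x2) < ereal (2 * \<epsilon> / \<delta>)))
       \<and> (asplund TYPE('a) \<longrightarrow>
            (\<forall>\<eta>::real. \<eta> > 0 \<longrightarrow>
              (\<exists>x1\<in>ball xb \<delta>. \<exists>x2\<in>ball xb \<delta>.
                 norm (x1 - x2) < \<eta> \<and>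
                 \<phi>1 x1 + \<phi>2 x2 < \<phi>1 xb + \<phi>2 xb + ereal \<eta> \<and>
                 edistance 0 (frechet_subdiff \<phi>1 x1 + frechet_subdiff \<phi>2 x2) < ereal (2 * \<epsilon> / \<delta>))))"
proof -
  have xb1: "xb \<in> edom \<phi>1" and xb2: "xb \<in> edom \<phi>2" using assms(5) by auto
  define f1 f2 where "f1 x = real_of_ereal (\<phi>1 x)" and "f2 x = real_of_ereal (\<phi>2 x)" for x
  have f1: "\<phi>1 x = ereal (f1 x)" if "x \<in> edom \<phi>1" for x
    using that assms(1) by (cases "\<phi>1 x") (auto simp: edom_def avoids_minus_infinity_def f1_def)
  have f2: "\<phi>2 x = ereal (f2 x)" if "x \<in> edom \<phi>2" for x
    using that assms(2) by (cases "\<phi>2 x") (auto simp: edom_def avoids_minus_infinity_def f2_def)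
  note pair = penalized_ekeland_pair[OF assms(1-4) xb1 xb2 assms(6-10), folded f1_def f2_def]
  show ?thesis
  proof (intro conjI allI impI)
    fix \<eta> :: real assume "0 < \<eta>"
    obtain z1 z2 R c \<gamma> where *: "R < \<delta>" "0 < c" "c < \<epsilon> / \<delta>" "0 \<le> \<gamma>"
      "z1 \<in> edom \<phi>1" "z2 \<in> edom \<phi>2" "norm (z1 - xb) < R" "norm (z2 - xb) < R"
      "norm (z1 - z2) < \<eta>" "f1 z1 + f2 z2 \<le> f1 xb + f2 xb"
      and min: "\<And>u1 u2. \<lbrakk>u1 \<in> edom \<phi>1 \<inter> cball xb R; u2 \<in> edom \<phi>2 \<inter> cball xb R\<rbrakk> \<Longrightarrow> f1 z1 + f2 z2 \<le>
      f1 u1 + f2 u2 + \<gamma> * norm ((u1 - z1) - (u2 - z2)) + c * norm (u1 - z1) + c * norm (u2 - z2)"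
      by (rule pair[OF \<open>0 < \<eta>\<close>]) (rule that; (assumption | blast))
    define s where "s = min (R - norm (z1 - xb)) (R - norm (z2 - xb))"
    have s: "0 < s" using * by (simp add: s_def)
    have in_cball: "u \<in> cball xb R" if "norm (u - z) < s" "norm (z - xb) \<le> R - s" for u z
      using norm_triangle_ineq[of "u - z" "z - xb"] that by (simp add: dist_norm norm_minus_commute)
    have local: "f1 z1 + f2 z2 \<le> r1 + r2 + \<gamma> * norm ((u1 - z1) - (u2 - z2)) + c * norm (u1 - z1) + c * norm (u2 - z2)"
      if "norm (u1 - z1) < s" "norm (u2 - z2) < s" "\<phi>1 u1 \<le> ereal r1" "\<phi>2 u2 \<le> ereal r2" for u1 u2 r1 r2
    proof -
      have e: "u1 \<in> edom \<phi>1" "u2 \<in> edom \<phi>2" using that by (auto simp: edom_def le_less_trans)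
      then have "f1 u1 \<le> r1" "f2 u2 \<le> r2" using that f1 f2 by auto
      moreover have "u1 \<in> cball xb R" "u2 \<in> cball xb R" using that in_cball by (auto simp: s_def)
      ultimately show ?thesis using min[of u1 u2] e by simp
    qed
    obtain a b where "a \<in> clarke_subdiff \<phi>1 z1" "b \<in> clarke_subdiff \<phi>2 z2" "norm (a + b) \<le> 2 * c"
      by (rule clarke_fuzzy_sum[where ?\<phi>1.0 = \<phi>1 and ?\<phi>2.0 = \<phi>2 and ?z1.0 = z1 and ?z2.0 = z2, OF f1[OF *(5)] f2[OF *(6)] *(4) less_imp_le[OF *(2)] s])
        (assumption | rule local | rule that)+
    moreover have "2 * c < 2 * \<epsilon> / \<delta>" using *(3) by simp
    ultimately have "edistance 0 (clarke_subdiff \<phi>1 z1 + clarke_subdiff \<phi>2 z2) < ereal (2 * \<epsilon> / \<delta>)"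
      by (intro edistance_set_plus_less) auto
    then show "\<exists>x1\<in>ball xb \<delta>. \<exists>x2\<in>ball xb \<delta>. norm (x1 - x2) < \<eta> \<and> \<phi>1 x1 + \<phi>2 x2 \<le> \<phi>1 xb + \<phi>2 xb \<and>
        edistance 0 (clarke_subdiff \<phi>1 x1 + clarke_subdiff \<phi>2 x2) < ereal (2 * \<epsilon> / \<delta>)"
      using * f1[OF *(5)] f2[OF *(6)] f1[OF xb1] f2[OF xb2]
      by (intro bexI[of _ z1] bexI[of _ z2] conjI) (auto simp: dist_norm norm_minus_commute)
  next
    fix \<eta> :: real assume asplund: "asplund TYPE('a)" and "0 < \<eta>"
    obtain z1 z2 R c \<gamma> where *: "R < \<delta>" "0 < c" "c < \<epsilon> / \<delta>" "0 \<le> \<gamma>"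
      "z1 \<in> edom \<phi>1" "z2 \<in> edom \<phi>2" "norm (z1 - xb) < R" "norm (z2 - xb) < R"
      "norm (z1 - z2) < \<eta>" "f1 z1 + f2 z2 \<le> f1 xb + f2 xb"
      and min: "\<And>u1 u2. \<lbrakk>u1 \<in> edom \<phi>1 \<inter> cball xb R; u2 \<in> edom \<phi>2 \<inter> cball xb R\<rbrakk> \<Longrightarrow> f1 z1 + f2 z2 \<le>
      f1 u1 + f2 u2 + \<gamma> * norm ((u1 - z1) - (u2 - z2)) + c * norm (u1 - z1) + c * norm (u2 - z2)"
      by (rule pair[OF \<open>0 < \<eta>\<close>]) (rule that; (assumption | blast))
    define c' where "c' = (c + \<epsilon> / \<delta>) / 2"
    have c': "c < c'" "c' < \<epsilon> / \<delta>" using *(3) unfolding c'_def by argo+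
    \<comment> \<open>One eighth of the smallest slack suffices: the points move by at most \<open>2 * \<kappa>\<close>, the values by
      \<open>3 * \<kappa>\<close>, and the functionals add up to at most \<open>2 * c' + 4 * \<kappa>\<close>.\<close>
    define s where "s = Min {\<eta> - norm (z1 - z2), \<eta>, R - norm (z1 - xb), R - norm (z2 - xb), \<epsilon> / \<delta> - c'}"
    define \<kappa> where "\<kappa> = s / 8"
    have "0 < s" using * c' \<open>0 < \<eta>\<close> by (simp add: s_def)
    moreover have "s \<le> \<eta> - norm (z1 - z2)" "s \<le> \<eta>" "s \<le> R - norm (z1 - xb)" "s \<le> R - norm (z2 - xb)" "s \<le> \<epsilon> / \<delta> - c'"
      unfolding s_def by (rule Min_le; simp)+
    ultimately have \<kappa>: "0 < \<kappa>" "8 * \<kappa> \<le> \<eta> - norm (z1 - z2)" "8 * \<kappa> \<le> \<eta>" "8 * \<kappa> \<le> R - norm (z1 - xb)"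
      "8 * \<kappa> \<le> R - norm (z2 - xb)" "8 * \<kappa> \<le> \<epsilon> / \<delta> - c'" by (auto simp: \<kappa>_def)
    define D1 D2 where "D1 = edom \<phi>1 \<inter> cball xb R" and "D2 = edom \<phi>2 \<inter> cball xb R"
    have lsc1: "seq_lsc_on D1 f1" and lsc2: "seq_lsc_on D2 f2"
      unfolding D1_def D2_def f1_def f2_def
      by (intro seq_lsc_on_Int_closed closed_cball seq_lsc_on_lsc assms)+
    have zD: "z1 \<in> D1" "z2 \<in> D2" using * by (auto simp: D1_def D2_def dist_norm norm_minus_commute)
    obtain y1 y2 a t where y: "norm (y1 - z1) \<le> \<kappa>" "norm (y2 - z2) \<le> \<kappa>" "f1 y1 + f2 y2 \<le> f1 z1 + f2 z2 + \<kappa>"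
      and supp: "eps_support D1 f1 y1 a \<kappa> t" "eps_support D2 f2 y2 (- a) (2 * c' + \<kappa>) t"
      using decoupled_supports[OF asplund lsc1 lsc2 zD *(4) less_imp_le[OF *(2)] c'(1) \<kappa>(1) \<kappa>(1)
          min[folded D1_def D2_def]] by blast
    have "0 \<le> 2 * c' + \<kappa>" using *(2) c'(1) \<kappa>(1) by linarith
    obtain x1 a1 where x1: "norm (x1 - y1) \<le> \<kappa>" "f1 x1 \<le> f1 y1 + \<kappa>" "norm (a1 - a) \<le> \<kappa> + \<kappa>" "x1 \<in> D1"
      and ex1: "\<And>e. 0 < e \<Longrightarrow> \<exists>t. eps_support D1 f1 x1 a1 e t"
      using exact_support_near[OF asplund lsc1 supp(1) less_imp_le[OF \<kappa>(1)] \<kappa>(1)] by blast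
    obtain x2 a2 where x2: "norm (x2 - y2) \<le> \<kappa>" "f2 x2 \<le> f2 y2 + \<kappa>" "norm (a2 - (- a)) \<le> 2 * c' + \<kappa> + \<kappa>" "x2 \<in> D2"
      and ex2: "\<And>e. 0 < e \<Longrightarrow> \<exists>t. eps_support D2 f2 x2 a2 e t"
      using exact_support_near[OF asplund lsc2 supp(2) \<open>0 \<le> 2 * c' + \<kappa>\<close> \<kappa>(1)] by blast
    have xz: "norm (x1 - z1) \<le> 2 * \<kappa>" "norm (x2 - z2) \<le> 2 * \<kappa>"
      using norm_triangle_ineq[of "x1 - y1" "y1 - z1"] norm_triangle_ineq[of "x2 - y2" "y2 - z2"] x1(1) x2(1) y by auto
    have xR: "norm (x1 - xb) < R" "norm (x2 - xb) < R"
      using norm_triangle_ineq[of "x1 - z1" "z1 - xb"] norm_triangle_ineq[of "x2 - z2" "z2 - xb"] xz \<kappa> by auto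
    have "norm (x1 - x2) \<le> norm (x1 - z1) + norm (z1 - z2) + norm (x2 - z2)"
      using norm_triangle_ineq[of "x1 - z1" "z1 - z2"] norm_triangle_ineq4[of "x1 - z2" "x2 - z2"] by simp
    then have x12: "norm (x1 - x2) < \<eta>" using xz \<kappa> by linarith
    have ball_support: "eps_support (edom \<phi> \<inter> ball xb R) f x b e t"
      if "eps_support (edom \<phi> \<inter> cball xb R) f x b e t" "norm (x - xb) < R"
      for \<phi> :: "'a \<Rightarrow> ereal" and f x b e t
      using that by (auto simp: eps_support_def dist_norm norm_minus_commute)
    have "a1 \<in> frechet_subdiff \<phi>1 x1"
    proof (rule frechet_subdiffI[OF assms(1) _ open_ball])
      show "x1 \<in> edom \<phi>1" "x1 \<in> ball xb R" using x1(4) xR by (auto simp: D1_def dist_norm norm_minus_commute)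
      show "\<exists>t. eps_support (edom \<phi>1 \<inter> ball xb R) (\<lambda>u. real_of_ereal (\<phi>1 u)) x1 a1 e t" if "0 < e" for e
        using ex1[OF that] ball_support[OF _ xR(1)] unfolding D1_def f1_def[abs_def] by blast
    qed
    moreover have "a2 \<in> frechet_subdiff \<phi>2 x2"
    proof (rule frechet_subdiffI[OF assms(2) _ open_ball])
      show "x2 \<in> edom \<phi>2" "x2 \<in> ball xb R" using x2(4) xR by (auto simp: D2_def dist_norm norm_minus_commute)
      show "\<exists>t. eps_support (edom \<phi>2 \<inter> ball xb R) (\<lambda>u. real_of_ereal (\<phi>2 u)) x2 a2 e t" if "0 < e" for e
        using ex2[OF that] ball_support[OF _ xR(2)] unfolding D2_def f2_def[abs_def] by blast
    qed
    moreover have "norm (a1 + a2) < 2 * \<epsilon> / \<delta>"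
    proof -
      have "norm (a1 + a2) \<le> norm (a1 - a) + norm (a2 - (- a))"
        using norm_triangle_ineq[of "a1 - a" "a2 - (- a)"] by simp
      also have "\<dots> < 2 * (\<epsilon> / \<delta>)" using x1(3) x2(3) \<kappa> by linarith
      finally show ?thesis by simp
    qed
    ultimately have "edistance 0 (frechet_subdiff \<phi>1 x1 + frechet_subdiff \<phi>2 x2) < ereal (2 * \<epsilon> / \<delta>)"
      by (rule edistance_set_plus_less)
    moreover have "\<phi>1 x1 + \<phi>2 x2 < \<phi>1 xb + \<phi>2 xb + ereal \<eta>"
    proof -
      have "f1 x1 + f2 x2 < f1 xb + f2 xb + \<eta>" using x1(2) x2(2) y(3) *(10) \<kappa> by linarith
      then show ?thesis using f1[of x1] f2[of x2] f1[OF xb1] f2[OF xb2] x1(4) x2(4) by (simp add: D1_def D2_def)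
    qed
    ultimately show "\<exists>x1\<in>ball xb \<delta>. \<exists>x2\<in>ball xb \<delta>. norm (x1 - x2) < \<eta> \<and> \<phi>1 x1 + \<phi>2 x2 < \<phi>1 xb + \<phi>2 xb + ereal \<eta> \<and>
        edistance 0 (frechet_subdiff \<phi>1 x1 + frechet_subdiff \<phi>2 x2) < ereal (2 * \<epsilon> / \<delta>)"
      using x12 xR *(1) by (intro bexI[of _ x1] bexI[of _ x2] conjI) (auto simp: dist_norm norm_minus_commute)
  qed
qed

end
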